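(* Let $C$ and $D$ be similarity classes of matrices over a finite field $\mathbf{F}_q$. Then $C$ and $D$ commute if and only if the class types $\mathrm{ty}(C)$ and $\mathrm{ty}(D)$ commute over $\mathbf{F}_q$.
   Context: A partition is a weakly decreasing finite sequence of positive integers $\lambda=(\lambda(1),\lambda(2),\dots)$, whose terms are its parts. Let $K$ be a field and $M\in\mathrm{Mat}_n(K)$. Let $f_1,\dots,f_t$ be the distinct monic irreducible factors over $K$ of the characteristic polynomial of $M$. For each $i$, let $\lambda_i$ be the partition such that the $f_i$-primary component of the $K[x]$-module $K^n$ (with $x$ acting as $M$) is isomorphic to $\bigoplus_j K[x]/(f_i^{\lambda_i(j)})$. The class type of $M$ is the formal string $\mathrm{ty}(M)=d_1^{\lambda_1}\cdots d_t^{\lambda_t}$, where $d_i=\deg f_i$; the order of the terms is unimportant (so the class type is the multiset of pairs $(d_i,\lambda_i)$). Similar matrices have the same class type, so $\mathrm{ty}(C)$ is well defined for a similarity class $C$. Two similarity classes $C$ and $D$ commute if there exist commuting matrices $X\in C$ and $Y\in D$ (in particular, of the same size). Two class types $S$ and $T$ commute over a field $K$ if there are commuting matrices $X$ and $Y$ with entries in $K$ such that $X$ has class type $S$ and $Y$ has class type $T$. *)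

theory Defs
  imports
    "HOL-Library.Multiset"
    "HOL-Algebra.QuotRing"
    "Jordan_Normal_Form.Char_Poly"
    "Jordan_Normal_Form.VS_Connect"
begin

hide_const (open) Multiset.mult

text \<open>Square matrices are the elements of \<open>carrier_mat n n\<close> (the size \<open>n = 0\<close> is allowed).
  The polynomial ring \<open>K[x]\<close> is \<open>class_ring\<close> at type \<open>'a poly\<close>, and \<open>K[x]\<close>-modules are
  records of type \<open>('a poly, 'b) module\<close>. Their ring fields \<open>mult\<close> and \<open>one\<close> play no role for modules
  and are left \<open>undefined\<close>, as in \<^const>\<open>module_vec\<close>.\<close>

section \<open>The module of a matrix and its primary components\<close>

definition poly_mat :: "'a::field poly \<Rightarrow> 'a mat \<Rightarrow> 'a mat" where
  "poly_mat p M =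
     mat (dim_row M) (dim_row M) (\<lambda>(i, j). \<Sum>k\<le>degree p. coeff p k * (M ^\<^sub>m k) $$ (i, j))"

definition poly_module :: "'a::field mat \<Rightarrow> ('a poly, 'a vec) module" where
  "poly_module M =
     \<lparr>carrier = carrier_vec (dim_row M), mult = undefined, one = undefined,
      zero = 0\<^sub>v (dim_row M), add = (+), smult = (\<lambda>p v. poly_mat p M *\<^sub>v v)\<rparr>"

definition primary_component :: "'a::field mat \<Rightarrow> 'a poly \<Rightarrow> ('a poly, 'a vec) module" where
  "primary_component M f =
     (poly_module M)\<lparr>carrier := {v \<in> carrier (poly_module M).
        \<exists>k::nat. (f ^ k) \<odot>\<^bsub>poly_module M\<^esub> v = \<zero>\<^bsub>poly_module M\<^esub>}\<rparr>"

section \<open>Cyclic modules, direct sums, isomorphism\<close>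

text \<open>\<open>K[x]/(g)\<close>: the additive group of the quotient ring, with \<open>p\<close> acting as
  multiplication by the coset of \<open>p\<close>.\<close>

definition cyclic_module :: "'a::field poly \<Rightarrow> ('a poly, 'a poly set) module" where
  "cyclic_module g =
     (let R = (class_ring :: 'a poly ring); I = PIdl\<^bsub>R\<^esub> g; Q = R Quot I
      in \<lparr>carrier = carrier Q, mult = undefined, one = undefined, zero = zero Q, add = add Q,
          smult = (\<lambda>p A. (I +>\<^bsub>R\<^esub> p) \<otimes>\<^bsub>Q\<^esub> A)\<rparr>)"

definition direct_sum_list :: "('r, 'b) module list \<Rightarrow> ('r, 'b list) module" where
  "direct_sum_list Ms =
     \<lparr>carrier = {xs. length xs = length Ms \<and> (\<forall>j<length Ms. xs ! j \<in> carrier (Ms ! j))},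
      mult = undefined, one = undefined,
      zero = map zero Ms,
      add = (\<lambda>xs ys. map (\<lambda>j. xs ! j \<oplus>\<^bsub>Ms ! j\<^esub> ys ! j) [0..<length Ms]),
      smult = (\<lambda>r xs. map (\<lambda>j. r \<odot>\<^bsub>Ms ! j\<^esub> (xs ! j)) [0..<length Ms])\<rparr>"

definition module_isomorphic :: "'r ring \<Rightarrow> ('r, 'b) module \<Rightarrow> ('r, 'c) module \<Rightarrow> bool" where
  "module_isomorphic R M N \<longleftrightarrow>
     (\<exists>\<phi> \<in> LinearCombinations.module_hom R M N. bij_betw \<phi> (carrier M) (carrier N))"

section \<open>Class types\<close>

definition is_partition :: "nat list \<Rightarrow> bool" where
  "is_partition \<mu> \<longleftrightarrow> sorted_wrt (\<ge>) \<mu> \<and> (\<forall>k \<in> set \<mu>. 0 < k)"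

definition primary_partition :: "'a::field mat \<Rightarrow> 'a poly \<Rightarrow> nat list" where
  "primary_partition M f =
     (THE \<mu>. is_partition \<mu> \<and>
        module_isomorphic class_ring (primary_component M f)
          (direct_sum_list (map (\<lambda>k. cyclic_module (f ^ k)) \<mu>)))"

text \<open>The string \<open>d\<^sub>1\<^bsup>\<lambda>\<^sub>1\<^esup> \<dots> d\<^sub>t\<^bsup>\<lambda>\<^sub>t\<^esup>\<close> is the multiset of the pairs \<open>(d\<^sub>i, \<lambda>\<^sub>i)\<close>.\<close>

type_synonym class_type = "(nat \<times> nat list) multiset"

definition ty :: "'a::field mat \<Rightarrow> class_type" where
  "ty M = image_mset (\<lambda>f. (degree f, primary_partition M f))
     (mset_set {f. lead_coeff f = 1 \<and> irreducible f \<and> f dvd char_poly M})"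

section \<open>Similarity classes and commuting\<close>

definition is_similarity_class :: "'a::field mat set \<Rightarrow> bool" where
  "is_similarity_class C \<longleftrightarrow> (\<exists>n. \<exists>M \<in> carrier_mat n n. C = {N. similar_mat M N})"

text \<open>The common value of \<^const>\<open>ty\<close> on the members of \<open>C\<close>.\<close>

definition ty_class :: "'a::field mat set \<Rightarrow> class_type" where
  "ty_class C = the_elem (ty ` C)"

text \<open>The product of matrices is total in the library, hence the explicit sizes.\<close>

definition commuting_mats :: "'a::field mat \<Rightarrow> 'a mat \<Rightarrow> bool" where
  "commuting_mats X Y \<longleftrightarrow>
     (\<exists>n. X \<in> carrier_mat n n \<and> Y \<in> carrier_mat n n \<and> X * Y = Y * X)"

definition classes_commute :: "'a::field mat set \<Rightarrow> 'a mat set \<Rightarrow> bool" where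
  "classes_commute C D \<longleftrightarrow> (\<exists>X \<in> C. \<exists>Y \<in> D. commuting_mats X Y)"

definition class_types_commute :: "'a::field itself \<Rightarrow> class_type \<Rightarrow> class_type \<Rightarrow> bool" where
  "class_types_commute K S T \<longleftrightarrow>
     (\<exists>X Y :: 'a mat. commuting_mats X Y \<and> ty X = S \<and> ty Y = T)"

end

(* Over a finite field, matrices M and N with the same class type satisfy g(M) ~ N for a suitable
   polynomial g, so commuting members of the two types can be replaced by polynomials in them.

   To find g, match the irreducible factors f of M with factors h of N of the same degree and
   partition. Finite fields of equal order being isomorphic, some g_f satisfies f | h(g_f) but not
   f^2 | h(g_f); glue the g_f modulo the f^2. Then h(g(M))^k and f(M)^k have equal kernels for all k.

   The sizes of the kernels of all f(M)^k, f irreducible, determine M up to similarity: by the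
   structure theorem for finite primary K[x]-modules they determine the partition of each primary
   component, and K^n is the sum of these. *)
theory Submission
  imports
    Defs
    "HOL-Library.Cardinality"
    "HOL-Library.Function_Algebras"
    "HOL-Algebra.Algebraic_Closure_Type"
begin

hide_const (open) Divisibility.irreducible Polynomials.degree Polynomials.lead_coeff
  up_ring.coeff up_ring.monom Multiset.mult

section \<open>Comaximal polynomials and cyclic modules\<close>

text \<open>Equal types match the irreducible factors of \<open>M\<close> and \<open>N\<close> only
  by degree and partition, so the two matrices may have entirely different eigenvalues. Substituting
  \<open>M\<close> into a polynomial changes the eigenvalues, yet the result commutes with whatever
  commutes with \<open>M\<close>; this is why the two members of a commuting pair can be moved
  independently. Finiteness of the field decides whether a suitable polynomial exists: over the
  rationals x^2 - 2 has no root in K[x]/(x^2 - 3), although the degrees agree. A root g of h modulo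
  f is not yet enough. If f^2 divided h(g), the kernel of h(g(M)) would contain that of f(M)^2, and
  the larger blocks of \<open>M\<close> would break up. That f divides h(g) exactly once depends
  only on g modulo f^2, so gluing modulo f^2 serves all exponents in the partitions. Since the field
  is finite, the number of elements of a kernel does the work of its dimension. Coprimality is kept
  as a Bezout identity throughout: such an identity can be applied to an element of a module, and it
  survives substitution.\<close>

definition comaximal :: "'a::comm_ring_1 \<Rightarrow> 'a \<Rightarrow> bool" where
  "comaximal a b \<longleftrightarrow> (\<exists>u v. u * a + v * b = 1)"

lemma comaximal_sym: "comaximal a b \<Longrightarrow> comaximal b a"
  by (metis comaximal_def add.commute)

lemma comaximal_one_right [simp]: "comaximal a 1"
  unfolding comaximal_def by (rule exI[of _ 0], rule exI[of _ 1]) simp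

lemma comaximal_mult_right:
  assumes "comaximal a b" "comaximal a c"
  shows "comaximal a (b * c)"
proof -
  obtain u v u' v' where 1: "u * a + v * b = 1" "u' * a + v' * c = 1"
    using assms unfolding comaximal_def by blast
  have "(u * a + v * b) * (u' * a + v' * c) = 1"
    by (simp add: 1)
  then have "(u * (u' * a + v' * c) + v * b * u') * a + (v * v') * (b * c) = 1"
    by (simp add: algebra_simps)
  then show ?thesis
    unfolding comaximal_def by blast
qed

lemma comaximal_power_right: "comaximal a b \<Longrightarrow> comaximal a (b ^ n)"
  by (induction n) (auto intro: comaximal_mult_right)

lemma comaximal_prod_right: "(\<And>i. i \<in> I \<Longrightarrow> comaximal a (b i)) \<Longrightarrow> comaximal a (prod b I)"
  by (induction I rule: infinite_finite_induct) (auto intro: comaximal_mult_right)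

lemma comaximal_dvd_mult:
  assumes "comaximal a b" "a dvd b * c"
  shows "a dvd c"
proof -
  obtain u v where "u * a + v * b = 1"
    using assms(1) unfolding comaximal_def by blast
  then have "c = (u * a + v * b) * c"
    by simp
  then have "c = a * (u * c) + v * (b * c)"
    by (simp add: algebra_simps)
  then show ?thesis
    using assms(2) by (metis dvd_add dvd_mult dvd_triv_left)
qed

text \<open>An element of least degree among the nonzero combinations of \<open>f\<close> and
  \<open>p\<close> divides all of them, by division with remainder. It divides the irreducible
  \<open>f\<close>, so it is a unit, which gives the identity, or an associate of \<open>f\<close>,
  which would give \<open>f dvd p\<close>.\<close>

lemma irreducible_comaximal:
  fixes f p :: "'a::field poly"
  assumes "irreducible f" "\<not> f dvd p"
  shows "comaximal f p"
proof -
  define S where "S = {m. m \<noteq> 0 \<and> (\<exists>u v. m = u * f + v * p)}"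
  have "1 * f + 0 * p \<in> S"
    using assms(1) unfolding S_def Factorial_Ring.irreducible_def by fastforce
  then obtain m where mS: "m \<in> S" and min: "\<And>m'. m' \<in> S \<Longrightarrow> degree m \<le> degree m'"
    using ex_has_least_nat[of "\<lambda>m. m \<in> S" _ degree] by blast
  then obtain u v where m: "m \<noteq> 0" "m = u * f + v * p"
    by (auto simp: S_def)
  have dvd: "m dvd a * f + b * p" for a b
  proof (rule ccontr)
    assume n: "\<not> m dvd a * f + b * p"
    let ?r = "(a * f + b * p) mod m"
    have "?r \<noteq> 0"
      using n by (auto simp: mod_eq_0_iff_dvd)
    have "?r = (a * f + b * p) - (a * f + b * p) div m * m"
      by (simp add: minus_div_mult_eq_mod)
    also have "\<dots> = (a - (a * f + b * p) div m * u) * f + (b - (a * f + b * p) div m * v) * p"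
      by (subst (2) m(2)) (simp add: algebra_simps)
    finally have "?r \<in> S"
      using \<open>?r \<noteq> 0\<close> unfolding S_def by blast
    then show False
      using min degree_mod_less[OF m(1), of "a * f + b * p"] \<open>?r \<noteq> 0\<close> by fastforce
  qed
  have "m dvd f" "m dvd p"
    using dvd[of 1 0] dvd[of 0 1] by auto
  then obtain k where k: "f = m * k" by blast
  with assms(1) consider "is_unit m" | "is_unit k"
    using Factorial_Ring.irreducibleD by blast
  then show ?thesis
  proof cases
    case 1
    then obtain w where "m * w = 1" by (metis dvd_def)
    then have "(u * f + v * p) * w = 1"
      using m(2) by simp
    then have "(w * u) * f + (w * v) * p = 1"
      by (simp add: algebra_simps)
    then show ?thesis
      unfolding comaximal_def by blast
  next
    case 2
    then have "f dvd m"
      unfolding k by simp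
    with \<open>m dvd p\<close> assms(2) show ?thesis
      by (metis dvd_trans)
  qed
qed

text \<open>Once the elements and operations of \<open>cyclic_module\<close> are expressed through
  these cosets, every computation in K[x]/(g) becomes a statement about divisibility.\<close>

definition residue_class :: "'a::comm_ring_1 \<Rightarrow> 'a \<Rightarrow> 'a set" where
  "residue_class g c = {p. g dvd p - c}"

lemma residue_class_eq_iff: "residue_class g a = residue_class g b \<longleftrightarrow> g dvd a - b"
proof
  assume "residue_class g a = residue_class g b"
  moreover have "a \<in> residue_class g a"
    by (simp add: residue_class_def)
  ultimately show "g dvd a - b"
    by (simp add: residue_class_def)
next
  assume *: "g dvd a - b"
  have "g dvd p - a \<longleftrightarrow> g dvd p - b" for p
    using dvd_add_left_iff[OF *, of "p - a"] by simp
  then show "residue_class g a = residue_class g b"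
    by (simp add: residue_class_def)
qed

lemma
  fixes g :: "'a::field poly"
  shows carrier_cyclic_module: "carrier (cyclic_module g) = range (residue_class g)"
    and zero_cyclic_module: "zero (cyclic_module g) = residue_class g 0"
    and add_cyclic_module: "add (cyclic_module g) (residue_class g a) (residue_class g b) = residue_class g (a + b)"
    and smult_cyclic_module: "smult (cyclic_module g) p (residue_class g a) = residue_class g (p * a)"
proof -
  let ?R = "class_ring :: 'a poly ring"
  let ?I = "PIdl\<^bsub>?R\<^esub> g"
  interpret I: ideal ?I ?R
    using cring.cgenideal_ideal[OF class_cring.is_cring, of g] by simp
  have I: "?I = range (\<lambda>x. x * g)"
    unfolding cgenideal_def by auto
  have coset: "?I +>\<^bsub>?R\<^esub> c = residue_class g c" for c
  proof -
    have "p \<in> ?I +>\<^bsub>?R\<^esub> c \<longleftrightarrow> p \<in> residue_class g c" for p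
    proof -
      have "p \<in> ?I +>\<^bsub>?R\<^esub> c \<longleftrightarrow> (\<exists>x. p = x * g + c)"
        unfolding a_r_coset_def' I by auto
      also have "\<dots> \<longleftrightarrow> (\<exists>x. p - c = g * x)"
        by (simp add: diff_eq_eq mult.commute)
      finally show ?thesis
        by (simp add: residue_class_def dvd_def)
    qed
    then show ?thesis by blast
  qed
  have zero: "?I = residue_class g 0"
    unfolding I residue_class_def by (auto simp: dvd_def mult.commute)
  show "carrier (cyclic_module g) = range (residue_class g)"
    by (auto simp: cyclic_module_def Let_def FactRing_def A_RCOSETS_def' class_ring_simps coset)
  show "zero (cyclic_module g) = residue_class g 0"
    by (auto simp: cyclic_module_def Let_def FactRing_def zero)
  show "add (cyclic_module g) (residue_class g a) (residue_class g b) = residue_class g (a + b)"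
    using I.a_rcos_sum[of a b]
    by (simp add: cyclic_module_def Let_def FactRing_def coset class_ring_simps)
  show "smult (cyclic_module g) p (residue_class g a) = residue_class g (p * a)"
    using I.rcoset_mult_add[of p a]
    by (simp add: cyclic_module_def Let_def FactRing_def coset class_ring_simps)
qed

section \<open>Structure of finite primary modules\<close>

text \<open>Keeps the map visible, because isomorphisms will be composed, inverted and added
  up.\<close>

definition module_iso :: "('b \<Rightarrow> 'c) \<Rightarrow> ('a, 'b) module \<Rightarrow> ('a, 'c) module \<Rightarrow> bool" where
  "module_iso \<phi> M N \<longleftrightarrow> bij_betw \<phi> (carrier M) (carrier N) \<and>
     (\<forall>x\<in>carrier M. \<forall>y\<in>carrier M. \<phi> (x \<oplus>\<^bsub>M\<^esub> y) = \<phi> x \<oplus>\<^bsub>N\<^esub> \<phi> y) \<and>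
     (\<forall>p. \<forall>x\<in>carrier M. \<phi> (p \<odot>\<^bsub>M\<^esub> x) = p \<odot>\<^bsub>N\<^esub> \<phi> x)"

lemma module_isomorphic_iff: "module_isomorphic class_ring M N \<longleftrightarrow> (\<exists>\<phi>. module_iso \<phi> M N)"
  unfolding module_isomorphic_def module_iso_def LinearCombinations.module_hom_def Bex_def mem_Collect_eq
  by (intro ex_cong1) (auto dest: bij_betw_imp_funcset)

lemma module_iso_trans:
  assumes "module_iso \<phi> L M" "module_iso \<psi> M N"
  shows "module_iso (\<psi> \<circ> \<phi>) L N"
  using assms unfolding module_iso_def
  by (auto intro: bij_betw_trans dest: bij_betwE)

text \<open>\<open>M\<close> is a bare record, so its closure has to be assumed: a sum in
  \<open>N\<close> is rewritten as the image of a sum in \<open>M\<close>, and the inverse undoes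
  \<open>\<phi>\<close> only on the carrier.\<close>

lemma module_iso_inv:
  assumes "module_iso \<phi> M N"
    and add: "\<And>x y. x \<in> carrier M \<Longrightarrow> y \<in> carrier M \<Longrightarrow> x \<oplus>\<^bsub>M\<^esub> y \<in> carrier M"
    and smult: "\<And>p x. x \<in> carrier M \<Longrightarrow> p \<odot>\<^bsub>M\<^esub> x \<in> carrier M"
  shows "module_iso (inv_into (carrier M) \<phi>) N M"
proof -
  let ?\<psi> = "inv_into (carrier M) \<phi>"
  have bij: "bij_betw \<phi> (carrier M) (carrier N)"
    and hom: "\<And>x y. x \<in> carrier M \<Longrightarrow> y \<in> carrier M \<Longrightarrow> \<phi> (x \<oplus>\<^bsub>M\<^esub> y) = \<phi> x \<oplus>\<^bsub>N\<^esub> \<phi> y"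
      "\<And>p x. x \<in> carrier M \<Longrightarrow> \<phi> (p \<odot>\<^bsub>M\<^esub> x) = p \<odot>\<^bsub>N\<^esub> \<phi> x"
    using assms(1) unfolding module_iso_def by blast+
  have \<psi>: "?\<psi> z \<in> carrier M" "\<phi> (?\<psi> z) = z" if "z \<in> carrier N" for z
    using that bij by (auto simp: bij_betw_def inv_into_into f_inv_into_f)
  have l: "?\<psi> (\<phi> x) = x" if "x \<in> carrier M" for x
    using that bij by (simp add: bij_betw_def)
  have "?\<psi> (x \<oplus>\<^bsub>N\<^esub> y) = ?\<psi> x \<oplus>\<^bsub>M\<^esub> ?\<psi> y" if "x \<in> carrier N" "y \<in> carrier N" for x y
    using l[OF add[of "?\<psi> x" "?\<psi> y"]] hom(1)[of "?\<psi> x" "?\<psi> y"] \<psi> that by simp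
  moreover have "?\<psi> (p \<odot>\<^bsub>N\<^esub> x) = p \<odot>\<^bsub>M\<^esub> ?\<psi> x" if "x \<in> carrier N" for p x
    using l[OF smult[of "?\<psi> x" p]] hom(2)[of "?\<psi> x" p] \<psi> that by simp
  ultimately show ?thesis
    unfolding module_iso_def using bij_betw_inv_into[OF bij] by blast
qed

section \<open>Direct sums of cyclic modules\<close>

lemma
  shows carrier_direct_sum_Nil: "carrier (direct_sum_list []) = {[]}"
    and carrier_direct_sum_Cons: "carrier (direct_sum_list (M # Ms)) =
      (\<lambda>(x, xs). x # xs) ` (carrier M \<times> carrier (direct_sum_list Ms))"
    and zero_direct_sum_Nil: "zero (direct_sum_list []) = []"
    and zero_direct_sum_Cons: "zero (direct_sum_list (M # Ms)) = zero M # zero (direct_sum_list Ms)"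
    and add_direct_sum_Nil: "add (direct_sum_list []) xs ys = []"
    and add_direct_sum_Cons: "add (direct_sum_list (M # Ms)) (x # xs) (y # ys) =
      add M x y # add (direct_sum_list Ms) xs ys"
    and smult_direct_sum_Nil: "smult (direct_sum_list []) p xs = []"
    and smult_direct_sum_Cons: "smult (direct_sum_list (M # Ms)) p (x # xs) =
      smult M p x # smult (direct_sum_list Ms) p xs"
proof -
  have "ys \<in> carrier (direct_sum_list (M # Ms)) \<longleftrightarrow>
    ys \<in> (\<lambda>(x, xs). x # xs) ` (carrier M \<times> carrier (direct_sum_list Ms))" for ys
    by (cases ys) (auto simp: direct_sum_list_def nth_Cons split: nat.splits)
  then show "carrier (direct_sum_list (M # Ms)) =
      (\<lambda>(x, xs). x # xs) ` (carrier M \<times> carrier (direct_sum_list Ms))"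
    by blast
qed (auto simp: direct_sum_list_def map_upt_Suc simp del: upt_Suc)

abbreviation cyclic_sum :: "'a::field poly \<Rightarrow> nat list \<Rightarrow> ('a poly, 'a poly set list) module" where
  "cyclic_sum f ks \<equiv> direct_sum_list (map (\<lambda>k. cyclic_module (f ^ k)) ks)"

text \<open>Zero written as \<open>0 \<odot> xs\<close> is carried along by any map that respects
  the action, so isomorphisms into a cyclic sum are seen to preserve zero.\<close>

lemma smult_zero_cyclic_sum:
  assumes "xs \<in> carrier (cyclic_sum f ks)"
  shows "0 \<odot>\<^bsub>cyclic_sum f ks\<^esub> xs = \<zero>\<^bsub>cyclic_sum f ks\<^esub>"
  using assms
  by (induction ks arbitrary: xs)
    (auto simp: carrier_direct_sum_Nil carrier_direct_sum_Cons smult_direct_sum_Nil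
      smult_direct_sum_Cons zero_direct_sum_Nil zero_direct_sum_Cons carrier_cyclic_module
      smult_cyclic_module zero_cyclic_module)

text \<open>Test \<open>p\<close> on the class of 1 in the summand belonging to \<open>k\<close>. In
  the structure theorem this bounds the remaining parts by the first one.\<close>

lemma cyclic_sum_killed_imp_dvd:
  assumes "\<And>xs. xs \<in> carrier (cyclic_sum f ks) \<Longrightarrow> p \<odot>\<^bsub>cyclic_sum f ks\<^esub> xs = \<zero>\<^bsub>cyclic_sum f ks\<^esub>"
    and "k \<in> set ks"
  shows "f ^ k dvd p"
  using assms
proof (induction ks)
  case (Cons k' ks)
  have ne: "\<exists>xs. xs \<in> carrier (cyclic_sum f ks)"
    by (induction ks) (auto simp: carrier_direct_sum_Nil carrier_direct_sum_Cons carrier_cyclic_module)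
  have *: "p \<odot>\<^bsub>cyclic_module (f ^ k')\<^esub> x = \<zero>\<^bsub>cyclic_module (f ^ k')\<^esub> \<and>
      p \<odot>\<^bsub>cyclic_sum f ks\<^esub> xs = \<zero>\<^bsub>cyclic_sum f ks\<^esub>"
    if "x \<in> carrier (cyclic_module (f ^ k'))" "xs \<in> carrier (cyclic_sum f ks)" for x xs
    using Cons.prems(1)[of "x # xs"] that
    by (auto simp: carrier_direct_sum_Cons smult_direct_sum_Cons zero_direct_sum_Cons)
  have "f ^ k' dvd p"
    using *[of "residue_class (f ^ k') 1"] ne
    by (auto simp: carrier_cyclic_module smult_cyclic_module zero_cyclic_module residue_class_eq_iff)
  moreover have "f ^ k dvd p" if "k \<in> set ks"
    using * that by (intro Cons.IH) (auto simp: carrier_cyclic_module)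
  ultimately show ?case
    using Cons.prems(2) by auto
qed simp

section \<open>Submodules of K[x]-modules and the splitting of finite primary ones\<close>

definition submodule_record :: "('a \<Rightarrow> 'b::ab_group_add \<Rightarrow> 'b) \<Rightarrow> 'b set \<Rightarrow> ('a, 'b) module" where
  "submodule_record s W = \<lparr>carrier = W, mult = undefined, one = undefined, zero = 0, add = (+), smult = s\<rparr>"

lemma submodule_record_simps [simp]:
  "carrier (submodule_record s W) = W"
  "zero (submodule_record s W) = 0"
  "add (submodule_record s W) = (+)"
  "smult (submodule_record s W) = s"
  by (simp_all add: submodule_record_def)

text \<open>The scalars are polynomials, so the inherited \<open>subspace\<close> means
  K[x]-submodule here.\<close>

locale poly_action = Modules.module scale
  for scale :: "'a::field poly \<Rightarrow> 'b::ab_group_add \<Rightarrow> 'b" (infixr "*s" 75)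
begin

text \<open>Induction on the power \<open>j\<close> of \<open>f\<close> that divides
  \<open>p\<close>. If \<open>p = f ^ j * r\<close> with \<open>j \<le> m\<close> and
  \<open>f\<close> did not divide \<open>r\<close>, then \<open>r\<close> would be invertible modulo
  \<open>f ^ Suc m\<close>, and \<open>f ^ m *s v\<close> would be a multiple of
  \<open>p *s v = 0\<close>.\<close>

lemma annihilator_primary:
  assumes "irreducible f" "f ^ Suc m *s v = 0" "f ^ m *s v \<noteq> 0" "p *s v = 0"
  shows "f ^ Suc m dvd p"
proof -
  have "f ^ j dvd p" if "j \<le> Suc m" for j
    using that
  proof (induction j)
    case (Suc j)
    then have "f ^ j dvd p" by simp
    then obtain r where r: "p = f ^ j * r" by (rule dvdE)
    have "f dvd r"
    proof (rule ccontr)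
      assume "\<not> f dvd r"
      then have "comaximal r (f ^ Suc m)"
        using assms(1) irreducible_comaximal comaximal_sym comaximal_power_right by blast
      then obtain a b where ab: "a * r + b * f ^ Suc m = 1"
        unfolding comaximal_def by blast
      have "f ^ m *s v = f ^ m *s (a * r + b * f ^ Suc m) *s v"
        by (simp only: ab scale_one)
      also have "\<dots> = (f ^ m * a * r) *s v + (f ^ m * b) *s (f ^ Suc m *s v)"
        by (simp add: algebra_simps del: power_Suc)
      also have "f ^ m * a * r = (f ^ (m - j) * a) * p"
        using Suc.prems by (simp add: r mult.assoc mult.left_commute flip: power_add)
      finally show False
        using assms by (simp flip: scale_scale)
    qed
    then show ?case
      unfolding r by (metis mult_dvd_mono dvd_refl power_Suc2)
  qed simp
  then show ?thesis by blast
qed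

lemma subspace_add_cyclic:
  assumes "subspace U"
  shows "subspace {u + c *s v | u c. u \<in> U}"
proof (rule subspaceI)
  show "0 \<in> {u + c *s v | u c. u \<in> U}"
    using subspace_0[OF assms] by (auto intro!: exI[of _ 0])
next
  fix x y assume "x \<in> {u + c *s v | u c. u \<in> U}" "y \<in> {u + c *s v | u c. u \<in> U}"
  then obtain u c u' c' where "x = u + c *s v" "y = u' + c' *s v" "u \<in> U" "u' \<in> U"
    by blast
  then have "x + y = (u + u') + (c + c') *s v" "u + u' \<in> U"
    using subspace_add[OF assms] by (auto simp: algebra_simps)
  then show "x + y \<in> {u + c *s v | u c. u \<in> U}" by blast
next
  fix a x assume "x \<in> {u + c *s v | u c. u \<in> U}"
  then obtain u c where "x = u + c *s v" "u \<in> U"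
    by blast
  then have "a *s x = a *s u + (a * c) *s v" "a *s u \<in> U"
    using subspace_scale[OF assms] by (auto simp: algebra_simps)
  then show "a *s x \<in> {u + c *s v | u c. u \<in> U}" by blast
qed

text \<open>A vector of the largest possible order generates a direct summand. Among the submodules
  of the finite \<open>W\<close> that meet the multiples of \<open>v\<close> only in 0, a maximal
  one is a complement: any vector of \<open>W\<close> outside its sum with those multiples would
  allow an enlargement.\<close>

lemma cyclic_complement:
  assumes f: "irreducible f" and W: "subspace W" "finite W"
    and kill: "\<And>w. w \<in> W \<Longrightarrow> f ^ Suc m *s w = 0"
    and v: "v \<in> W" "f ^ m *s v \<noteq> 0"
  obtains U where "subspace U" "U \<subseteq> W" "\<And>c. c *s v \<in> U \<Longrightarrow> c *s v = 0"
    "W = {u + c *s v | u c. u \<in> U}"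
proof -
  define P where "P U \<longleftrightarrow> subspace U \<and> U \<subseteq> W \<and> (\<forall>c. c *s v \<in> U \<longrightarrow> c *s v = 0)" for U
  have "P {0}"
    using subspace_0[OF W(1)] by (simp add: P_def)
  moreover have "finite {U. P U}"
    using W(2) by (rule finite_subset[rotated, OF finite_Pow_iff[THEN iffD2]]) (auto simp: P_def)
  ultimately obtain U where U: "P U" and max: "\<And>U'. P U' \<Longrightarrow> U \<subseteq> U' \<Longrightarrow> U' = U"
    using finite_has_maximal2[of "{U. P U}" "{0}"] by auto
  have sU: "subspace U" "U \<subseteq> W" "\<And>c. c *s v \<in> U \<Longrightarrow> c *s v = 0"
    using U by (auto simp: P_def)
  let ?S = "{u + c *s v | u c. u \<in> U}"
  have sS: "subspace ?S"
    by (rule subspace_add_cyclic[OF sU(1)])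
  have US: "U \<subseteq> ?S"
    using scale_zero_left by (force intro: exI[of _ 0])
  have "W \<subseteq> ?S"
  proof (rule ccontr)
    assume "\<not> W \<subseteq> ?S"
    then obtain w0 where w0: "w0 \<in> W" "w0 \<notin> ?S" by blast
    \<comment> \<open>Multiplying by \<open>f\<close> eventually leads into \<open>?S\<close>; the
      last vector outside satisfies \<open>f *s w \<in> ?S\<close>.\<close>
    obtain j where j: "f ^ j *s w0 \<notin> ?S" "f ^ Suc j *s w0 \<in> ?S"
    proof -
      have "f ^ 0 *s w0 \<notin> ?S" using w0(2) by simp
      moreover have "f ^ Suc m *s w0 \<in> ?S"
        using kill[OF w0(1)] subspace_0[OF sS] by simp
      ultimately show thesis
        using that ex_least_nat_less[of "\<lambda>j. f ^ j *s w0 \<in> ?S" "Suc m"] by blast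
    qed
    define w where "w = f ^ j *s w0"
    have w: "w \<in> W" "w \<notin> ?S" "f *s w \<in> ?S"
      using j w0(1) subspace_scale[OF W(1)] by (auto simp: w_def)
    then obtain u c where u: "u \<in> U" "f *s w = u + c *s v" by blast
    \<comment> \<open>The maximal order of \<open>v\<close> enters here: applying
      \<open>f ^ m\<close> to \<open>f *s w = u + c *s v\<close> forces \<open>f dvd c\<close>, so
      that \<open>w\<close> can be corrected by a multiple of \<open>v\<close> to a
      \<open>w'\<close> with \<open>f *s w'\<close> in \<open>U\<close>.\<close>
    have "0 = f ^ m *s (f *s w)"
      using kill[OF w(1)] by (simp add: mult.commute)
    then have eq: "f ^ m *s u + (f ^ m * c) *s v = 0"
      by (simp add: u(2) algebra_simps)
    then have "(f ^ m * c) *s v = - (f ^ m *s u)"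
      by (simp add: eq_neg_iff_add_eq_0 add.commute)
    then have "(f ^ m * c) *s v \<in> U"
      using u(1) sU(1) by (simp add: subspace_neg subspace_scale)
    then have "(f ^ m * c) *s v = 0" by (rule sU(3))
    then have "f ^ Suc m dvd f ^ m * c"
      using annihilator_primary[OF f kill[OF v(1)] v(2)] by blast
    then have "f dvd c"
      using f by (metis power_Suc2 dvd_times_left_cancel_iff Factorial_Ring.irreducible_def power_not_zero)
    then obtain c' where c': "c = f * c'" by blast
    define w' where "w' = w - c' *s v"
    have w': "w' \<in> W" "f *s w' = u" "w' \<notin> ?S"
    proof -
      show "w' \<in> W"
        using w(1) v(1) W(1) by (simp add: w'_def subspace_diff subspace_scale)
      show "f *s w' = u"
        by (simp add: w'_def algebra_simps u(2) c')
      show "w' \<notin> ?S"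
      proof
        assume "w' \<in> ?S"
        then obtain u1 c1 where "u1 \<in> U" "w' = u1 + c1 *s v" by blast
        then have "w = u1 + (c1 + c') *s v" by (simp add: w'_def algebra_simps)
        with \<open>u1 \<in> U\<close> w(2) show False by blast
      qed
    qed
    \<comment> \<open>By maximality of \<open>U\<close> the larger submodule contains some nonzero
      \<open>a *s v = u' + b *s w'\<close>. If \<open>f\<close> divides \<open>b\<close>, the right
      side is already in \<open>U\<close>; otherwise \<open>b\<close> is invertible modulo
      \<open>f\<close> and \<open>w'\<close> falls into \<open>?S\<close>.\<close>
    let ?U' = "{u + b *s w' | u b. u \<in> U}"
    have "U \<subseteq> ?U'"
      using scale_zero_left by (force intro: exI[of _ 0])
    moreover have "w' \<in> ?U'"
      using subspace_0[OF sU(1)] by (force intro: exI[of _ 1])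
    moreover have "w' \<notin> U" using w'(3) US by blast
    ultimately have "\<not> P ?U'"
      using max[of ?U'] by blast
    moreover have "subspace ?U'"
      by (rule subspace_add_cyclic[OF sU(1)])
    moreover have "?U' \<subseteq> W"
      using sU(2) w'(1) W(1) by (auto intro!: subspace_add subspace_scale)
    ultimately obtain a where a: "a *s v \<in> ?U'" "a *s v \<noteq> 0"
      unfolding P_def by blast
    then obtain u' b where b: "u' \<in> U" "a *s v = u' + b *s w'" by blast
    show False
    proof (cases "f dvd b")
      case True
      then obtain b' where "b = b' * f" by (metis dvd_def mult.commute)
      then have "b *s w' = b' *s u"
        using w'(2) by (metis scale_scale)
      then have "a *s v \<in> U"
        using b u(1) sU(1) by (simp add: subspace_add subspace_scale)
      then show False using sU(3) a(2) by blast
    next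
      case False
      then obtain x y where xy: "x * f + y * b = 1"
        using irreducible_comaximal[OF f] unfolding comaximal_def by blast
      have "w' = x *s (f *s w') + y *s (b *s w')"
        by (metis scale_left_distrib scale_one scale_scale xy)
      moreover have "b *s w' = - u' + a *s v"
        by (simp add: b(2))
      ultimately have "w' = (x *s u + y *s (- u')) + (y * a) *s v"
        using w'(2) by (simp add: algebra_simps)
      moreover have "x *s u + y *s (- u') \<in> U"
        using u(1) b(1) sU(1) by (intro subspace_add subspace_scale subspace_neg)
      ultimately show False
        using w'(3) by blast
    qed
  qed
  moreover have "?S \<subseteq> W"
    using sU(2) v(1) W(1) by (auto intro!: subspace_add subspace_scale)
  ultimately show thesis
    using that[OF sU] by blast
qed

text \<open>\<open>W\<close> is the internal direct sum of \<open>U\<close> and the multiples of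
  \<open>v\<close>, and the annihilator identifies the latter with K[x]/(f^m), \<open>c *s v\<close>
  corresponding to the class of \<open>c\<close>.\<close>

lemma module_iso_cyclic_sum_Cons:
  assumes U: "subspace U" "\<And>c. c *s v \<in> U \<Longrightarrow> c *s v = 0" "W = {u + c *s v | u c. u \<in> U}"
    and ann: "\<And>p. p *s v = 0 \<longleftrightarrow> f ^ m dvd p"
    and iso: "module_iso \<phi> (submodule_record scale U) (cyclic_sum f ks)"
  shows "\<exists>\<psi>. module_iso \<psi> (submodule_record scale W) (cyclic_sum f (m # ks))"
proof -
  \<comment> \<open>The coefficient of \<open>v\<close> is determined only modulo
    \<open>f ^ m\<close>, so the choice made here disappears in the residue class.\<close>
  define \<gamma> where "\<gamma> w = (SOME c. w - c *s v \<in> U)" for w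
  define \<psi> where "\<psi> w = residue_class (f ^ m) (\<gamma> w) # \<phi> (w - \<gamma> w *s v)" for w
  have \<psi>: "\<psi> (u + c *s v) = residue_class (f ^ m) c # \<phi> u" if "u \<in> U" for u c
  proof -
    let ?w = "u + c *s v"
    have "?w - \<gamma> ?w *s v \<in> U"
      unfolding \<gamma>_def by (rule someI[of _ c]) (simp add: that)
    from subspace_diff[OF U(1) this that] have "(?w - \<gamma> ?w *s v) - u \<in> U" .
    then have "(c - \<gamma> ?w) *s v \<in> U"
      by (simp add: algebra_simps)
    then have 0: "(c - \<gamma> ?w) *s v = 0" by (rule U(2))
    then have "residue_class (f ^ m) c = residue_class (f ^ m) (\<gamma> ?w)"
      by (simp add: residue_class_eq_iff ann)
    moreover have "?w - \<gamma> ?w *s v = u"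
      using 0 by (simp add: algebra_simps)
    ultimately show ?thesis
      by (simp add: \<psi>_def)
  qed
  have bij: "bij_betw \<phi> U (carrier (cyclic_sum f ks))"
    and add: "\<And>x y. x \<in> U \<Longrightarrow> y \<in> U \<Longrightarrow> \<phi> (x + y) = \<phi> x \<oplus>\<^bsub>cyclic_sum f ks\<^esub> \<phi> y"
    and smult: "\<And>p x. x \<in> U \<Longrightarrow> \<phi> (p *s x) = p \<odot>\<^bsub>cyclic_sum f ks\<^esub> \<phi> x"
    using iso by (auto simp: module_iso_def)
  have "inj_on \<psi> W"
  proof (rule inj_onI)
    fix x y assume "x \<in> W" "y \<in> W" and eq: "\<psi> x = \<psi> y"
    then obtain u c u' c' where x: "x = u + c *s v" "y = u' + c' *s v" "u \<in> U" "u' \<in> U"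
      unfolding U(3) by blast
    with eq have "f ^ m dvd c - c'" "\<phi> u = \<phi> u'"
      by (auto simp: \<psi> residue_class_eq_iff)
    then have "u = u'" "(c - c') *s v = 0"
      using bij x ann by (auto simp: bij_betw_def inj_on_def)
    then show "x = y"
      using x by (simp add: algebra_simps)
  qed
  moreover have "\<psi> ` W = carrier (cyclic_sum f (m # ks))"
  proof -
    have "\<psi> ` W = (\<lambda>(x, xs). x # xs) ` (range (residue_class (f ^ m)) \<times> \<phi> ` U)"
      unfolding U(3) using \<psi> by (force simp: image_iff)
    also have "\<phi> ` U = carrier (cyclic_sum f ks)"
      using bij by (simp add: bij_betw_def)
    finally show ?thesis
      by (simp add: carrier_direct_sum_Cons carrier_cyclic_module)
  qed
  moreover have "\<psi> (x + y) = \<psi> x \<oplus>\<^bsub>cyclic_sum f (m # ks)\<^esub> \<psi> y" if xy: "x \<in> W" "y \<in> W" for x y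
  proof -
    obtain u c u' c' where x: "x = u + c *s v" "y = u' + c' *s v" "u \<in> U" "u' \<in> U"
      using xy unfolding U(3) by blast
    have xy: "x + y = (u + u') + (c + c') *s v"
      by (simp add: x algebra_simps)
    have "u + u' \<in> U"
      using U(1) x by (simp add: subspace_add)
    then have "\<psi> (x + y) = residue_class (f ^ m) (c + c') # \<phi> (u + u')"
      unfolding xy by (rule \<psi>)
    then show ?thesis
      using x by (simp add: \<psi> add add_direct_sum_Cons add_cyclic_module)
  qed
  moreover have "\<psi> (p *s x) = p \<odot>\<^bsub>cyclic_sum f (m # ks)\<^esub> \<psi> x" if xW: "x \<in> W" for x p
  proof -
    obtain u c where x: "x = u + c *s v" "u \<in> U"
      using xW unfolding U(3) by blast
    have px: "p *s x = p *s u + (p * c) *s v"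
      by (simp add: x algebra_simps)
    have "p *s u \<in> U"
      using U(1) x by (simp add: subspace_scale)
    then have "\<psi> (p *s x) = residue_class (f ^ m) (p * c) # \<phi> (p *s u)"
      unfolding px by (rule \<psi>)
    then show ?thesis
      using x by (simp add: \<psi> smult smult_direct_sum_Cons smult_cyclic_module)
  qed
  ultimately have "module_iso \<psi> (submodule_record scale W) (cyclic_sum f (m # ks))"
    by (simp add: module_iso_def bij_betw_def)
  then show ?thesis by blast
qed

text \<open>Induction on the number of elements: a vector of the largest order splits off a cyclic
  summand, and its exponent \<open>Suc m\<close> bounds the parts of the complement because
  \<open>f ^ Suc m\<close> kills all of \<open>W\<close>. The list is therefore weakly
  decreasing.\<close>

theorem primary_structure:
  assumes f: "irreducible f" and "subspace W" "finite W"
    and "\<And>w. w \<in> W \<Longrightarrow> \<exists>k. f ^ k *s w = 0"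
  shows "\<exists>ks. is_partition ks \<and> module_isomorphic class_ring (submodule_record scale W) (cyclic_sum f ks)"
proof -
  have "\<exists>ks \<phi>. is_partition ks \<and> module_iso \<phi> (submodule_record scale W) (cyclic_sum f ks)"
    using assms(2-4)
  proof (induction "card W" arbitrary: W rule: less_induct)
    case less
    note W = less.prems
    \<comment> \<open>The sum of the individual exponents over the finite \<open>W\<close> is a
      common one.\<close>
    have "\<exists>m. \<forall>w\<in>W. f ^ m *s w = 0"
    proof -
      obtain k where k: "\<And>w. w \<in> W \<Longrightarrow> f ^ k w *s w = 0"
        using W(3) by metis
      have "f ^ (\<Sum>w\<in>W. k w) *s w = 0" if "w \<in> W" for w
      proof -
        have "f ^ (\<Sum>w\<in>W. k w) = f ^ (\<Sum>w\<in>W - {w}. k w) * f ^ k w"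
          using W(2) that by (simp add: sum.remove[of W w] power_add mult.commute)
        then show ?thesis
          using k[OF that] by (simp flip: scale_scale)
      qed
      then show ?thesis by blast
    qed
    then obtain n where n: "\<forall>w\<in>W. f ^ n *s w = 0" and
      least: "\<And>m. m < n \<Longrightarrow> \<not> (\<forall>w\<in>W. f ^ m *s w = 0)"
      using exists_least_iff[of "\<lambda>m. \<forall>w\<in>W. f ^ m *s w = 0"] by blast
    show ?case
    proof (cases n)
      case 0
      then have "W = {0}"
        using n W(1) subspace_0 by auto
      then have "module_iso (\<lambda>_. []) (submodule_record scale W) (cyclic_sum f [])"
        by (simp add: module_iso_def carrier_direct_sum_Nil add_direct_sum_Nil smult_direct_sum_Nil)
      then show ?thesis
        by (intro exI[of _ "[]"]) (auto simp: is_partition_def)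
    next
      case (Suc m)
      then obtain v where v: "v \<in> W" "f ^ m *s v \<noteq> 0"
        using least[of m] by auto
      have kill: "\<And>w. w \<in> W \<Longrightarrow> f ^ Suc m *s w = 0"
        using n Suc by blast
      obtain U where U: "subspace U" "U \<subseteq> W" "\<And>c. c *s v \<in> U \<Longrightarrow> c *s v = 0"
          "W = {u + c *s v | u c. u \<in> U}"
        using cyclic_complement[OF f W(1,2) kill v] by blast
      have "v \<noteq> 0" using v(2) by auto
      then have "v \<notin> U" using U(3)[of 1] by auto
      then have "U \<subset> W" using U(2) v(1) by blast
      then have "card U < card W" using W(2) by (rule psubset_card_mono[rotated])
      moreover have "finite U" using U(2) W(2) finite_subset by blast
      ultimately obtain ks \<phi> where ks: "is_partition ks"
          "module_iso \<phi> (submodule_record scale U) (cyclic_sum f ks)"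
        using less.hyps[of U] U(1,2) W(3) by blast
      have "p *s v = 0 \<longleftrightarrow> f ^ Suc m dvd p" for p
        using annihilator_primary[OF f kill[OF v(1)] v(2), of p] kill[OF v(1)]
        by (metis dvd_def mult.commute scale_scale scale_zero_right)
      then obtain \<psi> where \<psi>: "module_iso \<psi> (submodule_record scale W) (cyclic_sum f (Suc m # ks))"
        using module_iso_cyclic_sum_Cons[OF U(1,3,4) _ ks(2)] by metis
      have "k \<le> Suc m" if "k \<in> set ks" for k
      proof -
        have bij: "bij_betw \<phi> U (carrier (cyclic_sum f ks))"
          and smult: "\<And>p x. x \<in> U \<Longrightarrow> \<phi> (p *s x) = p \<odot>\<^bsub>cyclic_sum f ks\<^esub> \<phi> x"
          using ks(2) by (auto simp: module_iso_def)
        have "f ^ Suc m \<odot>\<^bsub>cyclic_sum f ks\<^esub> xs = \<zero>\<^bsub>cyclic_sum f ks\<^esub>"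
          if xs: "xs \<in> carrier (cyclic_sum f ks)" for xs
        proof -
          obtain u where u: "u \<in> U" "xs = \<phi> u"
            using xs bij by (auto simp: bij_betw_def)
          have "f ^ Suc m *s u = 0 *s u"
            using kill u U(2) by (simp add: subset_iff)
          then have "f ^ Suc m \<odot>\<^bsub>cyclic_sum f ks\<^esub> xs = 0 \<odot>\<^bsub>cyclic_sum f ks\<^esub> xs"
            using smult[OF u(1)] u(2) by metis
          then show ?thesis using smult_zero_cyclic_sum[OF xs] by simp
        qed
        then have "f ^ k dvd f ^ Suc m"
          using cyclic_sum_killed_imp_dvd that by blast
        then show ?thesis
          using f by (metis dvd_power_iff Factorial_Ring.irreducible_def)
      qed
      then have "is_partition (Suc m # ks)"
        using ks(1) by (auto simp: is_partition_def)
      with \<psi> show ?thesis by blast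
    qed
  qed
  then show ?thesis
    by (simp add: module_isomorphic_iff)
qed

end

section \<open>Partitions and sizes of kernels\<close>

text \<open>The bound is put on the coefficients rather than on the degree so that the zero
  polynomial is counted also for \<open>n = 0\<close>.\<close>

lemma finite_card_polys_bounded:
  "finite {p :: 'a::{comm_monoid_add, finite} poly. \<forall>i\<ge>n. coeff p i = 0} \<and>
   card {p :: 'a poly. \<forall>i\<ge>n. coeff p i = 0} = CARD('a) ^ n"
proof (induction n)
  case 0
  have "{p :: 'a poly. \<forall>i\<ge>0. coeff p i = 0} = {0}"
    by (auto simp: poly_eq_iff)
  then show ?case by simp
next
  case (Suc n)
  let ?S = "\<lambda>n. {p :: 'a poly. \<forall>i\<ge>n. coeff p i = 0}"
  have "?S (Suc n) = (\<lambda>(a, p). pCons a p) ` (UNIV \<times> ?S n)"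
  proof (intro equalityI subsetI)
    fix p assume "p \<in> ?S (Suc n)"
    moreover obtain a q where "p = pCons a q" by (rule pCons_cases)
    ultimately have "q \<in> ?S n"
      by (auto simp: coeff_pCons)
    with \<open>p = pCons a q\<close> show "p \<in> (\<lambda>(a, p). pCons a p) ` (UNIV \<times> ?S n)"
      by auto
  qed (auto simp: coeff_pCons split: nat.splits)
  moreover have "inj_on (\<lambda>(a, p). pCons a p) (UNIV \<times> ?S n)"
    by (auto simp: inj_on_def)
  ultimately show ?case
    using Suc by (simp add: card_image card_cartesian_product)
qed

lemmas finite_polys_bounded = finite_card_polys_bounded[THEN conjunct1]
lemmas card_polys_bounded = finite_card_polys_bounded[THEN conjunct2]

lemma coeff_bounded_iff_degree_less:
  "(\<forall>i\<ge>n. coeff p i = 0) \<longleftrightarrow> p = 0 \<or> degree p < n"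
proof
  assume *: "\<forall>i\<ge>n. coeff p i = 0"
  show "p = 0 \<or> degree p < n"
  proof (rule ccontr)
    assume "\<not> (p = 0 \<or> degree p < n)"
    then have "coeff p (degree p) = 0" "p \<noteq> 0" using * by auto
    then show False by simp
  qed
qed (auto intro: coeff_eq_0)

lemma bounded_dvd_diff_imp_eq:
  fixes g p q :: "'a::field poly"
  assumes "g dvd p - q" "\<forall>i\<ge>degree g. coeff p i = 0" "\<forall>i\<ge>degree g. coeff q i = 0"
  shows "p = q"
proof (rule ccontr)
  assume "p \<noteq> q"
  have "\<forall>i\<ge>degree g. coeff (p - q) i = 0"
    using assms by simp
  then have "degree (p - q) < degree g"
    using \<open>p \<noteq> q\<close> coeff_bounded_iff_degree_less[of "degree g" "p - q"] by simp
  then show False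
    using dvd_imp_degree_le[OF assms(1)] \<open>p \<noteq> q\<close> by simp
qed

text \<open>The kernel of \<open>f ^ k\<close> on K[x]/(f^l) consists of the multiples of
  \<open>f ^ (l - m)\<close> with \<open>m = min k l\<close>; each of them is
  \<open>f ^ (l - m) * r\<close> for exactly one \<open>r\<close> reduced modulo
  \<open>f ^ m\<close>.\<close>

lemma card_kernel_cyclic:
  fixes f :: "'a::{field, finite} poly"
  assumes "f \<noteq> 0"
  shows "card {A \<in> carrier (cyclic_module (f ^ l)). f ^ k \<odot>\<^bsub>cyclic_module (f ^ l)\<^esub> A = \<zero>\<^bsub>cyclic_module (f ^ l)\<^esub>}
    = CARD('a) ^ (degree f * min k l)" (is "card ?K = _")
proof -
  define m where "m = min k l"
  let ?S = "{p :: 'a poly. \<forall>i\<ge>degree (f ^ m). coeff p i = 0}"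
  let ?h = "\<lambda>r. residue_class (f ^ l) (f ^ (l - m) * r)"
  have fl: "f ^ l = f ^ (l - m) * f ^ m"
    by (simp add: m_def flip: power_add)
  have eq: "?h r = ?h r' \<longleftrightarrow> f ^ m dvd r - r'" for r r'
    unfolding residue_class_eq_iff fl using assms
    by (simp flip: right_diff_distrib)
  have inj: "inj_on ?h ?S"
    by (rule inj_onI) (auto simp: eq intro: bounded_dvd_diff_imp_eq)
  have img: "?h ` ?S = ?K"
  proof (intro equalityI subsetI)
    fix A assume "A \<in> ?h ` ?S"
    then obtain r where r: "A = ?h r" by blast
    have "k + (l - m) \<ge> l" by (auto simp: m_def)
    then have "f ^ l dvd f ^ k * f ^ (l - m)"
      by (metis le_imp_power_dvd power_add)
    then have "f ^ l dvd f ^ k * (f ^ (l - m) * r)"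
      by (metis dvd_mult2 mult.assoc)
    then show "A \<in> ?K"
      by (auto simp: r carrier_cyclic_module smult_cyclic_module zero_cyclic_module residue_class_eq_iff)
  next
    fix A assume "A \<in> ?K"
    then obtain c where c: "A = residue_class (f ^ l) c"
      by (auto simp: carrier_cyclic_module)
    then have dvd: "f ^ l dvd f ^ k * c"
      using \<open>A \<in> ?K\<close> by (simp add: smult_cyclic_module zero_cyclic_module residue_class_eq_iff)
    have "f ^ (l - m) dvd c"
    proof (cases "k \<le> l")
      case True
      then have "f ^ k * f ^ (l - m) dvd f ^ k * c"
        using dvd by (simp add: m_def flip: power_add)
      then show ?thesis using assms by simp
    qed (simp add: m_def)
    then obtain e where e: "c = f ^ (l - m) * e" by blast
    let ?r = "e mod f ^ m"
    have "?r \<in> ?S"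
      unfolding coeff_bounded_iff_degree_less mem_Collect_eq
      by (rule degree_mod_less) (simp add: assms)
    moreover have "?h ?r = A"
      unfolding c e eq by (metis dvd_minus_mod minus_diff_eq dvd_minus_iff)
    ultimately show "A \<in> ?h ` ?S" by blast
  qed
  have "card ?K = card ?S"
    using card_image[OF inj] unfolding img .
  also have "\<dots> = CARD('a) ^ degree (f ^ m)"
    by (rule card_polys_bounded)
  finally show ?thesis
    using assms by (simp add: degree_power_eq m_def mult.commute)
qed

lemma card_kernel_cyclic_sum:
  fixes f :: "'a::{field, finite} poly"
  assumes "f \<noteq> 0"
  shows "card {xs \<in> carrier (cyclic_sum f ks). f ^ k \<odot>\<^bsub>cyclic_sum f ks\<^esub> xs = \<zero>\<^bsub>cyclic_sum f ks\<^esub>}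
    = CARD('a) ^ (degree f * sum_list (map (min k) ks))"
proof (induction ks)
  case Nil
  have "{xs \<in> carrier (cyclic_sum f []). f ^ k \<odot>\<^bsub>cyclic_sum f []\<^esub> xs = \<zero>\<^bsub>cyclic_sum f []\<^esub>} = {[]}"
    by (auto simp: carrier_direct_sum_Nil smult_direct_sum_Nil zero_direct_sum_Nil)
  then show ?case by simp
next
  case (Cons l ks)
  let ?K = "{A \<in> carrier (cyclic_module (f ^ l)). f ^ k \<odot>\<^bsub>cyclic_module (f ^ l)\<^esub> A = \<zero>\<^bsub>cyclic_module (f ^ l)\<^esub>}"
  let ?L = "\<lambda>ks. {xs \<in> carrier (cyclic_sum f ks). f ^ k \<odot>\<^bsub>cyclic_sum f ks\<^esub> xs = \<zero>\<^bsub>cyclic_sum f ks\<^esub>}"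
  have "?L (l # ks) = (\<lambda>(x, xs). x # xs) ` (?K \<times> ?L ks)"
    by (auto simp: carrier_direct_sum_Cons smult_direct_sum_Cons zero_direct_sum_Cons)
  moreover have "inj_on (\<lambda>(x, xs). x # xs) (?K \<times> ?L ks)"
    by (auto simp: inj_on_def)
  ultimately have "card (?L (l # ks)) = card ?K * card (?L ks)"
    by (simp add: card_image card_cartesian_product)
  then show ?case
    using Cons card_kernel_cyclic[OF assms, of l k] by (simp add: power_add algebra_simps)
qed

lemma (in poly_action) card_kernel_module_iso:
  assumes iso: "module_iso \<phi> (submodule_record scale W) N" and W: "subspace W"
    and N: "\<And>y. y \<in> carrier N \<Longrightarrow> 0 \<odot>\<^bsub>N\<^esub> y = \<zero>\<^bsub>N\<^esub>"
  shows "card {w \<in> W. p *s w = 0} = card {y \<in> carrier N. p \<odot>\<^bsub>N\<^esub> y = \<zero>\<^bsub>N\<^esub>}"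
proof -
  have bij: "bij_betw \<phi> W (carrier N)"
    and smult: "\<And>p x. x \<in> W \<Longrightarrow> \<phi> (p *s x) = p \<odot>\<^bsub>N\<^esub> \<phi> x"
    using iso by (auto simp: module_iso_def)
  have 0: "p *s x = 0 \<longleftrightarrow> p \<odot>\<^bsub>N\<^esub> \<phi> x = \<zero>\<^bsub>N\<^esub>" if "x \<in> W" for x
  proof -
    have "p *s x = 0 *s x \<longleftrightarrow> \<phi> (p *s x) = \<phi> (0 *s x)"
      using bij W that subspace_scale by (metis bij_betw_def inj_on_eq_iff)
    also have "\<dots> \<longleftrightarrow> p \<odot>\<^bsub>N\<^esub> \<phi> x = 0 \<odot>\<^bsub>N\<^esub> \<phi> x"
      by (simp only: smult[OF that])
    also have "0 \<odot>\<^bsub>N\<^esub> \<phi> x = \<zero>\<^bsub>N\<^esub>"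
      using bij that by (intro N) (auto simp: bij_betw_def)
    finally show ?thesis by simp
  qed
  have N_eq: "carrier N = \<phi> ` W"
    using bij by (simp add: bij_betw_def)
  have "{y \<in> carrier N. p \<odot>\<^bsub>N\<^esub> y = \<zero>\<^bsub>N\<^esub>} = \<phi> ` {w \<in> W. p *s w = 0}"
    unfolding N_eq using 0 by auto
  moreover have "inj_on \<phi> {w \<in> W. p *s w = 0}"
    using bij by (auto simp: bij_betw_def inj_on_def)
  ultimately show ?thesis
    by (simp add: card_image)
qed

text \<open>Passing from \<open>k\<close> to \<open>k + 1\<close>, the truncated sum grows by the
  number of parts exceeding \<open>k\<close>. The differences of these numbers are the
  multiplicities, and a weakly decreasing list is determined by its multiset.\<close>

lemma partition_eq_if_truncated_sums_eq:
  assumes "is_partition ks" "is_partition ls"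
    and sums: "\<And>k. sum_list (map (min k) ks) = sum_list (map (min k) ls)"
  shows "ks = ls"
proof -
  have step: "sum_list (map (min (Suc k)) xs) = sum_list (map (min k) xs) + length (filter (\<lambda>x. k < x) xs)"
    for k and xs :: "nat list"
    by (induction xs) auto
  have len: "length (filter (\<lambda>x. k < x) ks) = length (filter (\<lambda>x. k < x) ls)" for k
    using step[of k ks] step[of k ls] sums[of k] sums[of "Suc k"] by simp
  have cnt: "length (filter (\<lambda>x. k < x) xs) = length (filter (\<lambda>x. Suc k < x) xs) + count (mset xs) (Suc k)"
    for k and xs :: "nat list"
    by (induction xs) auto
  have "count (mset ks) k = count (mset ls) k" for k
  proof (cases k)
    \<comment> \<open>The differences give the multiplicities of positive numbers only; 0 is not a
      part by definition.\<close>
    case 0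
    then show ?thesis
      using assms(1,2) by (metis count_mset_0_iff is_partition_def less_not_refl)
  next
    case (Suc j)
    then show ?thesis
      using cnt[of j ks] cnt[of j ls] len[of j] len[of "Suc j"] by simp
  qed
  then have "mset (rev ks) = mset (rev ls)"
    by (simp add: multiset_eq_iff)
  moreover have "sorted (rev ks)" "sorted (rev ls)"
    using assms(1,2) by (simp_all add: is_partition_def sorted_wrt_rev)
  ultimately show ?thesis
    by (metis properties_for_sort rev_is_rev_conv)
qed

lemma card_kernel_cyclic_decomposition:
  fixes f :: "'a::{field, finite} poly"
  assumes "poly_action scale" "f \<noteq> 0" "Modules.module.subspace scale W" "module_isomorphic class_ring (submodule_record scale W) (cyclic_sum f ks)"
  shows "card {w \<in> W. scale (f ^ k) w = 0} = CARD('a) ^ (degree f * sum_list (map (min k) ks))"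
proof -
  interpret poly_action scale by fact
  obtain \<phi> where "module_iso \<phi> (submodule_record scale W) (cyclic_sum f ks)"
    using assms(4) by (auto simp: module_isomorphic_iff)
  from card_kernel_module_iso[OF this assms(3) smult_zero_cyclic_sum]
  show ?thesis
    by (simp add: card_kernel_cyclic_sum[OF assms(2)])
qed

section \<open>The polynomial action of a matrix\<close>

text \<open>Parallels the sum in \<open>poly_mat\<close>, with a vector in place of matrix entries,
  so that the two can be compared term by term.\<close>

definition poly_apply :: "('a::field \<Rightarrow> 'b::ab_group_add \<Rightarrow> 'b) \<Rightarrow> ('b \<Rightarrow> 'b) \<Rightarrow> 'a poly \<Rightarrow> 'b \<Rightarrow> 'b" where
  "poly_apply s T p w = (\<Sum>k\<le>degree p. s (coeff p k) ((T ^^ k) w))"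

locale linear_endomorphism = Modules.module s
  for s :: "'a::field \<Rightarrow> 'b::ab_group_add \<Rightarrow> 'b" +
  fixes T :: "'b \<Rightarrow> 'b"
  assumes T_add: "T (x + y) = T x + T y"
    and T_scale: "T (s c x) = s c (T x)"
begin

lemma T_zero: "T 0 = 0"
  using T_scale[of 0 0] by simp

lemma T_sum: "T (sum g A) = (\<Sum>x\<in>A. T (g x))"
  by (induction A rule: infinite_finite_induct) (simp_all add: T_add T_zero)

lemma poly_apply_bound:
  assumes "degree p \<le> n"
  shows "poly_apply s T p w = (\<Sum>k\<le>n. s (coeff p k) ((T ^^ k) w))"
  unfolding poly_apply_def using assms
  by (intro sum.mono_neutral_left) (auto simp: coeff_eq_0)

lemma poly_apply_0: "poly_apply s T 0 w = 0"
  by (simp add: poly_apply_def)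

text \<open>Horner's rule. It reduces the laws of the K[x]-action to inductions over
  \<open>pCons\<close>.\<close>

lemma poly_apply_pCons: "poly_apply s T (pCons a p) w = s a w + T (poly_apply s T p w)"
proof -
  have "degree (pCons a p) \<le> Suc (degree p)"
    by (rule degree_pCons_le)
  then have "poly_apply s T (pCons a p) w = (\<Sum>k\<le>Suc (degree p). s (coeff (pCons a p) k) ((T ^^ k) w))"
    by (rule poly_apply_bound)
  also have "\<dots> = s a w + (\<Sum>k\<le>degree p. s (coeff p k) ((T ^^ Suc k) w))"
    by (subst sum.atMost_Suc_shift) simp
  finally show ?thesis
    by (simp add: poly_apply_def T_sum T_scale)
qed

lemma poly_apply_const: "poly_apply s T [:a:] w = s a w"
  by (simp add: poly_apply_pCons poly_apply_0 T_zero)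

lemma poly_apply_X: "poly_apply s T [:0, 1:] w = T w"
  by (simp add: poly_apply_pCons poly_apply_0 T_zero)

lemma poly_apply_right_add: "poly_apply s T p (x + y) = poly_apply s T p x + poly_apply s T p y"
  by (induction p) (simp_all add: poly_apply_0 poly_apply_pCons T_add algebra_simps)

lemma poly_apply_left_add: "poly_apply s T (p + q) w = poly_apply s T p w + poly_apply s T q w"
proof (induction p arbitrary: q)
  case (pCons a p)
  obtain b r where "q = pCons b r" by (rule pCons_cases)
  then show ?case
    by (simp add: poly_apply_pCons pCons T_add algebra_simps)
qed (simp add: poly_apply_0)

lemma poly_apply_smult: "poly_apply s T (Polynomial.smult c p) w = s c (poly_apply s T p w)"
  by (induction p) (simp_all add: poly_apply_0 poly_apply_pCons T_scale algebra_simps)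

lemma poly_apply_mult: "poly_apply s T (p * q) w = poly_apply s T p (poly_apply s T q w)"
  by (induction p) (simp_all add: poly_apply_0 poly_apply_pCons poly_apply_left_add poly_apply_smult)

sublocale action: poly_action "poly_apply s T"
  by unfold_locales
    (simp_all add: poly_apply_right_add poly_apply_left_add poly_apply_mult poly_apply_const one_pCons)

text \<open>The hypothesis speaks of subspaces over the field, the conclusion of submodules over the
  polynomial ring.\<close>

lemma subspace_poly_apply:
  assumes "subspace W" "\<And>w. w \<in> W \<Longrightarrow> T w \<in> W"
  shows "action.subspace W"
proof -
  have "poly_apply s T p w \<in> W" if "w \<in> W" for p w
    by (induction p) (use that assms in \<open>auto simp: poly_apply_0 poly_apply_pCons subspace_0 intro!: subspace_add subspace_scale\<close>)
  then show ?thesis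
    using assms(1) by (auto intro!: action.subspaceI simp: subspace_0 subspace_add)
qed

end

section \<open>Square matrices as operators on coordinate functions\<close>

definition fun_scale :: "'a::times \<Rightarrow> ('i \<Rightarrow> 'a) \<Rightarrow> 'i \<Rightarrow> 'a" where
  "fun_scale c w = (\<lambda>i. c * w i)"

text \<open>Defined on all functions: values of \<open>w\<close> from the size on are ignored, and
  the result vanishes there. The operator is thus linear on the whole type, and for square matrices
  it is the matrix-vector product on \<open>coord_space\<close>.\<close>

definition mat_op :: "'a::field mat \<Rightarrow> (nat \<Rightarrow> 'a) \<Rightarrow> nat \<Rightarrow> 'a" where
  "mat_op M w = (\<lambda>i. if i < dim_row M then \<Sum>j<dim_row M. M $$ (i, j) * w j else 0)"

abbreviation mat_action :: "'a::field mat \<Rightarrow> 'a poly \<Rightarrow> (nat \<Rightarrow> 'a) \<Rightarrow> nat \<Rightarrow> 'a" where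
  "mat_action M \<equiv> poly_apply fun_scale (mat_op M)"

interpretation mat: linear_endomorphism fun_scale "mat_op M" for M :: "'a::field mat"
  by unfold_locales
    (auto simp: fun_scale_def mat_op_def algebra_simps sum.distrib sum_distrib_left fun_eq_iff)

text \<open>Vectors of all lengths form one type, on which addition is not a group law. Functions on
  the natural numbers do form a group, and those vanishing from \<open>n\<close> on are a copy of
  K^n in it; this makes the theory of submodules applicable.\<close>

definition coord_space :: "nat \<Rightarrow> (nat \<Rightarrow> 'a::zero) set" where
  "coord_space n = {w. \<forall>i\<ge>n. w i = 0}"

lemma subspace_coord_space:
  assumes "dim_row M = n"
  shows "mat.action.subspace M (coord_space n)"
  using assms
  by (intro mat.subspace_poly_apply mat.subspaceI)
    (auto simp: coord_space_def fun_scale_def mat_op_def)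

text \<open>Members are coefficient sequences of polynomials with the same bound, which have been
  counted already.\<close>

lemma finite_card_coord_space:
  "finite (coord_space n :: (nat \<Rightarrow> 'a::{comm_monoid_add, finite}) set) \<and>
   card (coord_space n :: (nat \<Rightarrow> 'a) set) = CARD('a) ^ n"
proof -
  let ?S = "{p :: 'a poly. \<forall>i\<ge>n. coeff p i = 0}"
  have eq: "coord_space n = coeff ` ?S"
  proof (intro equalityI subsetI)
    fix w :: "nat \<Rightarrow> 'a" assume w: "w \<in> coord_space n"
    then have "coeff (Abs_poly w) = w"
      by (intro coeff_Abs_poly[of n]) (simp add: coord_space_def)
    then show "w \<in> coeff ` ?S"
      using w by (force simp: coord_space_def image_iff intro: exI[of _ "Abs_poly w"])
  qed (auto simp: coord_space_def)
  have "inj_on coeff ?S"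
    by (auto intro: inj_onI simp: coeff_inject)
  then show ?thesis
    unfolding eq by (simp add: card_image finite_polys_bounded card_polys_bounded)
qed

lemmas finite_coord_space = finite_card_coord_space[THEN conjunct1]
lemmas card_coord_space = finite_card_coord_space[THEN conjunct2]

definition vec_fun :: "'a::zero vec \<Rightarrow> nat \<Rightarrow> 'a" where
  "vec_fun v = (\<lambda>i. if i < dim_vec v then v $ i else 0)"

lemma bij_betw_vec_fun: "bij_betw vec_fun (carrier_vec n) (coord_space n)"
proof (rule bij_betw_byWitness[where f' = "\<lambda>w. vec n w"])
  show "\<forall>v\<in>carrier_vec n. vec n (vec_fun v) = v"
    by (auto simp: vec_fun_def)
qed (auto simp: vec_fun_def coord_space_def fun_eq_iff)

lemma vec_fun_add:
  fixes u v :: "'a::monoid_add vec"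
  shows "u \<in> carrier_vec n \<Longrightarrow> v \<in> carrier_vec n \<Longrightarrow> vec_fun (u + v) = vec_fun u + vec_fun v"
  by (auto simp: vec_fun_def fun_eq_iff)

lemma vec_fun_eq_0_iff: "v \<in> carrier_vec n \<Longrightarrow> vec_fun v = 0 \<longleftrightarrow> v = 0\<^sub>v n"
  by (auto simp: vec_fun_def fun_eq_iff)

lemma vec_fun_mult_mat_vec:
  assumes "M \<in> carrier_mat n n" "v \<in> carrier_vec n"
  shows "vec_fun (M *\<^sub>v v) = mat_op M (vec_fun v)"
  using assms by (auto simp: vec_fun_def mat_op_def fun_eq_iff scalar_prod_def atLeast0LessThan intro!: sum.cong)

lemma vec_fun_pow_mat_vec:
  assumes "M \<in> carrier_mat n n" "v \<in> carrier_vec n"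
  shows "vec_fun ((M ^\<^sub>m k) *\<^sub>v v) = (mat_op M ^^ k) (vec_fun v)"
  using assms(2)
proof (induction k arbitrary: v)
  case 0
  then show ?case using assms by simp
next
  case (Suc k)
  have "(M ^\<^sub>m Suc k) *\<^sub>v v = (M ^\<^sub>m k) *\<^sub>v (M *\<^sub>v v)"
    using assms(1) Suc.prems by (simp add: assoc_mult_mat_vec[of _ n n _ n])
  also have "vec_fun \<dots> = (mat_op M ^^ k) (mat_op M (vec_fun v))"
    using Suc.IH[of "M *\<^sub>v v"] assms(1) Suc.prems by (simp add: vec_fun_mult_mat_vec)
  finally show ?case
    by (simp add: funpow_swap1)
qed

lemma poly_mat_carrier [simp]: "M \<in> carrier_mat n n \<Longrightarrow> poly_mat p M \<in> carrier_mat n n"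
  by (simp add: poly_mat_def)

lemma sum_fun_apply: "sum f A x = (\<Sum>a\<in>A. f a x)"
  by (induction A rule: infinite_finite_induct) auto

text \<open>Connects the entrywise definition of \<open>poly_mat\<close> with the module action:
  interchange the sum over the columns with the sum over the powers.\<close>

lemma vec_fun_poly_mat:
  assumes M: "M \<in> carrier_mat n n" and v: "v \<in> carrier_vec n"
  shows "vec_fun (poly_mat p M *\<^sub>v v) = mat_action M p (vec_fun v)"
proof
  fix i
  have rhs: "mat_action M p (vec_fun v) i = (\<Sum>k\<le>degree p. coeff p k * vec_fun ((M ^\<^sub>m k) *\<^sub>v v) i)"
    using assms by (simp add: poly_apply_def sum_fun_apply fun_scale_def vec_fun_pow_mat_vec)
  show "vec_fun (poly_mat p M *\<^sub>v v) i = mat_action M p (vec_fun v) i"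
  proof (cases "i < n")
    case True
    have "vec_fun (poly_mat p M *\<^sub>v v) i = (\<Sum>j<n. (\<Sum>k\<le>degree p. coeff p k * (M ^\<^sub>m k) $$ (i, j)) * v $ j)"
      using True M v by (simp add: vec_fun_def poly_mat_def scalar_prod_def atLeast0LessThan)
    also have "\<dots> = (\<Sum>k\<le>degree p. coeff p k * (\<Sum>j<n. (M ^\<^sub>m k) $$ (i, j) * v $ j))"
      unfolding sum_distrib_right sum_distrib_left mult.assoc by (rule sum.swap)
    also have "\<dots> = (\<Sum>k\<le>degree p. coeff p k * vec_fun ((M ^\<^sub>m k) *\<^sub>v v) i)"
    proof (rule sum.cong[OF refl])
      fix k
      have "M ^\<^sub>m k \<in> carrier_mat n n" using M by simp
      then show "coeff p k * (\<Sum>j<n. (M ^\<^sub>m k) $$ (i, j) * v $ j) = coeff p k * vec_fun ((M ^\<^sub>m k) *\<^sub>v v) i"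
        using True v by (auto simp: vec_fun_def scalar_prod_def atLeast0LessThan intro!: sum.cong)
    qed
    finally show ?thesis unfolding rhs .
  next
    case False
    have "dim_row (M ^\<^sub>m k) = n" for k
      using M by (metis carrier_matD(1) pow_carrier_mat)
    then have "vec_fun ((M ^\<^sub>m k) *\<^sub>v v) i = 0" for k
      using False by (simp add: vec_fun_def)
    then show ?thesis
      unfolding rhs using False M by (simp add: vec_fun_def poly_mat_def)
  qed
qed

definition primary_space :: "'a::field mat \<Rightarrow> 'a poly \<Rightarrow> (nat \<Rightarrow> 'a) set" where
  "primary_space M f = {w \<in> coord_space (dim_row M). \<exists>k. mat_action M (f ^ k) w = 0}"

lemma subspace_primary_space: "mat.action.subspace M (primary_space M f)"
proof (rule mat.action.subspaceI)
  note V = subspace_coord_space[OF refl, of M]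
  show "0 \<in> primary_space M f"
    using mat.action.subspace_0[OF V] by (simp add: primary_space_def)
  show "x + y \<in> primary_space M f" if "x \<in> primary_space M f" "y \<in> primary_space M f" for x y
  proof -
    obtain k l where kl: "mat_action M (f ^ k) x = 0" "mat_action M (f ^ l) y = 0"
      using \<open>x \<in> primary_space M f\<close> \<open>y \<in> primary_space M f\<close> unfolding primary_space_def by blast
    have "mat_action M (f ^ (k + l)) x = mat_action M (f ^ l) (mat_action M (f ^ k) x)"
      by (simp add: power_add mult.commute)
    moreover have "mat_action M (f ^ (k + l)) y = mat_action M (f ^ k) (mat_action M (f ^ l) y)"
      by (simp add: power_add)
    ultimately have "mat_action M (f ^ (k + l)) (x + y) = 0"
      by (simp add: kl mat.action.scale_right_distrib del: mat.action.scale_scale)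
    then show ?thesis
      using that mat.action.subspace_add[OF V] unfolding primary_space_def by blast
  qed
  show "mat_action M p x \<in> primary_space M f" if x: "x \<in> primary_space M f" for p x
  proof -
    obtain k where k: "mat_action M (f ^ k) x = 0"
      using x unfolding primary_space_def by blast
    have "mat_action M (f ^ k) (mat_action M p x) = mat_action M p (mat_action M (f ^ k) x)"
      by (rule mat.action.scale_left_commute)
    then have "mat_action M (f ^ k) (mat_action M p x) = 0"
      by (simp add: k del: mat.action.scale_scale)
    then show ?thesis
      using x mat.action.subspace_scale[OF V] unfolding primary_space_def by blast
  qed
qed

lemma in_carrier_primary_component_iff:
  assumes M: "M \<in> carrier_mat n n"
  shows "v \<in> carrier (primary_component M f) \<longleftrightarrow> v \<in> carrier_vec n \<and> vec_fun v \<in> primary_space M f"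
proof -
  have n: "dim_row M = n" using M by simp
  have "poly_mat p M *\<^sub>v v = 0\<^sub>v n \<longleftrightarrow> mat_action M p (vec_fun v) = 0" if "v \<in> carrier_vec n" for p
    using vec_fun_eq_0_iff[of "poly_mat p M *\<^sub>v v" n] vec_fun_poly_mat[OF M that, of p] M that
    by (metis mult_mat_vec_carrier poly_mat_carrier)
  moreover have "vec_fun v \<in> coord_space n" if "v \<in> carrier_vec n"
    using bij_betw_apply[OF bij_betw_vec_fun that] .
  ultimately show ?thesis
    by (auto simp: primary_component_def poly_module_def primary_space_def n)
qed

lemma
  shows add_primary_component: "add (primary_component M f) = (+)"
    and smult_primary_component: "smult (primary_component M f) = (\<lambda>p v. poly_mat p M *\<^sub>v v)"
  by (simp_all add: primary_component_def poly_module_def)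

lemma module_iso_primary_component:
  assumes M: "M \<in> carrier_mat n n"
  shows "module_iso vec_fun (primary_component M f) (submodule_record (mat_action M) (primary_space M f))"
proof -
  note car = in_carrier_primary_component_iff[OF M]
  have "w \<in> vec_fun ` carrier (primary_component M f)" if w: "w \<in> primary_space M f" for w
  proof -
    have "w \<in> coord_space n" using w M by (simp add: primary_space_def)
    then obtain v where "v \<in> carrier_vec n" "w = vec_fun v"
      unfolding bij_betw_imp_surj_on[OF bij_betw_vec_fun, symmetric] by blast
    then show ?thesis using w car by blast
  qed
  then have P: "vec_fun ` carrier (primary_component M f) = primary_space M f"
    using car by blast
  have "inj_on vec_fun (carrier (primary_component M f))"
    using bij_betw_imp_inj_on[OF bij_betw_vec_fun[of n]] by (rule inj_on_subset) (use car in blast)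
  then show ?thesis
    unfolding module_iso_def
    by (simp add: bij_betw_def P car add_primary_component smult_primary_component
        vec_fun_add[of _ n] vec_fun_poly_mat[OF M])
qed

lemma closed_primary_component:
  assumes M: "M \<in> carrier_mat n n"
  shows "x \<in> carrier (primary_component M f) \<Longrightarrow> y \<in> carrier (primary_component M f) \<Longrightarrow>
      x \<oplus>\<^bsub>primary_component M f\<^esub> y \<in> carrier (primary_component M f)"
    and "x \<in> carrier (primary_component M f) \<Longrightarrow>
      p \<odot>\<^bsub>primary_component M f\<^esub> x \<in> carrier (primary_component M f)"
  using mat.action.subspace_add[OF subspace_primary_space[of M f]]
    mat.action.subspace_scale[OF subspace_primary_space[of M f]] M
  unfolding in_carrier_primary_component_iff[OF M] add_primary_component smult_primary_component
  by (simp_all add: vec_fun_add[of _ n] vec_fun_poly_mat[OF M] mult_mat_vec_carrier[OF poly_mat_carrier[OF M]])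

section \<open>Unit vectors and the Cayley-Hamilton theorem\<close>

definition unit_fun :: "nat \<Rightarrow> nat \<Rightarrow> 'a::{zero, one}" where
  "unit_fun i = (\<lambda>j. if j = i then 1 else 0)"

lemma unit_fun_in_coord_space: "i < n \<Longrightarrow> unit_fun i \<in> coord_space n"
  by (auto simp: unit_fun_def coord_space_def)

lemma coord_space_expansion:
  fixes w :: "nat \<Rightarrow> 'a::semiring_1"
  assumes "w \<in> coord_space n"
  shows "w = (\<Sum>k<n. fun_scale (w k) (unit_fun k))"
  using assms by (auto simp: fun_eq_iff sum_fun_apply fun_scale_def unit_fun_def coord_space_def
      if_distrib cong: if_cong)

text \<open>The adjugate argument. With \<open>A\<close> = xI - M, each column of \<open>A\<close>
  is a relation among the unit vectors in the K[x]-module; combining the relations with the entries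
  of the adjugate \<open>B\<close> leaves \<open>det A\<close> acting as zero on every unit
  vector.\<close>

lemma cayley_hamilton_action:
  assumes M: "M \<in> carrier_mat n n" and v: "v \<in> coord_space n"
  shows "mat_action M (char_poly M) v = 0"
proof -
  define e :: "nat \<Rightarrow> nat \<Rightarrow> 'a" where "e = unit_fun"
  define A where "A = char_poly_matrix M"
  define B where "B = adj_mat A"
  have A: "A \<in> carrier_mat n n"
    using M by (simp add: A_def)
  have B: "B \<in> carrier_mat n n" "A * B = det A \<cdot>\<^sub>m 1\<^sub>m n"
    using adj_mat[OF A] by (simp_all add: B_def)
  have A_ij: "A $$ (j, i) = (if j = i then [:0, 1:] else 0) + [:- (M $$ (j, i)):]" if "i < n" "j < n" for i j
    using that M by (auto simp: A_def char_poly_matrix_def)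
  \<comment> \<open>Since x acts as \<open>M\<close>, multiplying the unit vector \<open>e i\<close>
    by x gives column \<open>i\<close> of \<open>M\<close>.\<close>
  have rel: "(\<Sum>j<n. mat_action M (A $$ (j, i)) (e j)) = 0" if i: "i < n" for i
  proof -
    have "(\<Sum>j<n. mat_action M (A $$ (j, i)) (e j)) =
        (\<Sum>j<n. (if j = i then mat_op M (e i) else 0) + fun_scale (- (M $$ (j, i))) (e j))"
      using i by (intro sum.cong[OF refl])
        (auto simp: A_ij mat.poly_apply_left_add mat.poly_apply_const mat.poly_apply_X mat.poly_apply_0
          simp del: add_pCons)
    also have "\<dots> = mat_op M (e i) + (\<Sum>j<n. fun_scale (- (M $$ (j, i))) (e j))"
      unfolding sum.distrib using i by simp
    also have "\<dots> = 0"
      using i M by (auto simp: fun_eq_iff sum_fun_apply mat_op_def fun_scale_def e_def unit_fun_def if_distrib cong: if_cong)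
    finally show ?thesis .
  qed
  have kill: "mat_action M (det A) (e k) = 0" if k: "k < n" for k
  proof -
    have "0 = (\<Sum>i<n. mat_action M (B $$ (i, k)) (\<Sum>j<n. mat_action M (A $$ (j, i)) (e j)))"
      by (simp add: rel)
    also have "\<dots> = (\<Sum>i<n. \<Sum>j<n. mat_action M (A $$ (j, i) * B $$ (i, k)) (e j))"
      by (simp add: mat.action.scale_sum_right mult.commute)
    also have "\<dots> = (\<Sum>j<n. mat_action M (\<Sum>i<n. A $$ (j, i) * B $$ (i, k)) (e j))"
      by (subst sum.swap) (simp add: mat.action.scale_sum_left)
    also have "\<dots> = (\<Sum>j<n. mat_action M ((A * B) $$ (j, k)) (e j))"
      using A B(1) k by (intro sum.cong) (auto simp: scalar_prod_def atLeast0LessThan)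
    also have "\<dots> = (\<Sum>j<n. if j = k then mat_action M (det A) (e k) else 0)"
      unfolding B(2) using k by (intro sum.cong) auto
    finally show ?thesis
      using k by simp
  qed
  have "v = (\<Sum>k<n. mat_action M [:v k:] (e k))"
    using coord_space_expansion[OF v] by (simp only: e_def mat.poly_apply_const)
  then have "mat_action M (det A) v = mat_action M (det A) (\<Sum>k<n. mat_action M [:v k:] (e k))"
    by simp
  also have "\<dots> = (\<Sum>k<n. mat_action M [:v k:] (mat_action M (det A) (e k)))"
    by (simp add: mat.action.scale_sum_right mult.commute)
  also have "\<dots> = 0"
    by (simp add: kill)
  finally show ?thesis
    by (simp add: A_def char_poly_def)
qed

section \<open>Gluing isomorphisms of primary parts\<close>

lemma comaximal_dvd_both:
  assumes "comaximal a b" "a dvd c" "b dvd c"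
  shows "a * b dvd c"
proof -
  obtain d where d: "c = b * d" using assms(3) by (rule dvdE)
  then have "a dvd d" using assms(1,2) comaximal_dvd_mult by blast
  then show ?thesis unfolding d by (metis dvd_refl mult.commute mult_dvd_mono)
qed

lemma comaximal_prod_dvd:
  assumes "finite I" "\<And>i j. i \<in> I \<Longrightarrow> j \<in> I \<Longrightarrow> i \<noteq> j \<Longrightarrow> comaximal (a i) (a j)"
    and "\<And>i. i \<in> I \<Longrightarrow> a i dvd c"
  shows "prod a I dvd c"
  using assms
proof (induction I rule: finite_induct)
  case (insert i I)
  have "comaximal (a i) (prod a I)"
    using insert by (intro comaximal_prod_right) auto
  moreover have "prod a I dvd c"
    using insert by auto
  ultimately show ?case
    using insert by (simp add: comaximal_dvd_both)
qed simp

text \<open>The Chinese remainder theorem: a Bezout identity for \<open>a i\<close> and the product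
  of the others yields \<open>e i\<close>. The last property makes \<open>e i\<close> map a module
  killed by the whole product into the part killed by \<open>a i\<close>.\<close>

lemma comaximal_idempotents:
  assumes "finite I" "\<And>i j. i \<in> I \<Longrightarrow> j \<in> I \<Longrightarrow> i \<noteq> j \<Longrightarrow> comaximal (a i) (a j)"
  shows "\<exists>e. (\<forall>i\<in>I. a i dvd e i - 1) \<and> (\<forall>i\<in>I. \<forall>j\<in>I. i \<noteq> j \<longrightarrow> a i dvd e j) \<and>
    (\<forall>i\<in>I. prod a I dvd a i * e i)"
proof -
  have "\<exists>e. a i dvd e - 1 \<and> prod a (I - {i}) dvd e" if "i \<in> I" for i
  proof -
    have "comaximal (a i) (prod a (I - {i}))"
      using assms(2) that by (intro comaximal_prod_right) auto
    then obtain u v where uv: "u * a i + v * prod a (I - {i}) = 1"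
      unfolding comaximal_def by blast
    then have "v * prod a (I - {i}) - 1 = a i * - u"
      by (simp add: algebra_simps eq_diff_eq)
    then show ?thesis
      by (metis dvd_triv_left dvd_triv_right)
  qed
  then obtain e where e: "\<And>i. i \<in> I \<Longrightarrow> a i dvd e i - 1"
      "\<And>i. i \<in> I \<Longrightarrow> prod a (I - {i}) dvd e i"
    by metis
  have "a i dvd e j" if "i \<in> I" "j \<in> I" "i \<noteq> j" for i j
    using dvd_trans[OF dvd_prodI e(2)[OF that(2)], of i] that assms(1) by simp
  moreover have "prod a I dvd a i * e i" if "i \<in> I" for i
    using e(2)[OF that] that assms(1) by (simp add: prod.remove mult_dvd_mono)
  ultimately show ?thesis
    using e(1) by (intro exI[of _ e]) simp
qed

lemma monic_irreducible_dvd_imp_eq: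
  fixes f g :: "'a::field poly"
  assumes "irreducible f" "irreducible g" "lead_coeff f = 1" "lead_coeff g = 1" "f dvd g"
  shows "f = g"
proof -
  obtain k where k: "g = f * k" using assms(5) by (rule dvdE)
  then have "is_unit k"
    using assms(1,2) by (metis Factorial_Ring.irreducibleD Factorial_Ring.irreducible_not_unit)
  then obtain c where "k = [:c:]" by (metis is_unit_polyE)
  then show ?thesis
    using k assms(3,4) by (auto split: if_splits)
qed

lemma monic_irreducible_comaximal:
  fixes f g :: "'a::field poly"
  assumes "irreducible f" "irreducible g" "lead_coeff f = 1" "lead_coeff g = 1" "f \<noteq> g"
  shows "comaximal f g"
  using assms monic_irreducible_dvd_imp_eq irreducible_comaximal by blast

lemma comaximal_powers: "comaximal a b \<Longrightarrow> comaximal (a ^ m) (b ^ n)"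
  by (meson comaximal_power_right comaximal_sym)

text \<open>The primary parts of both modules are cut out by the same idempotent polynomials, so
  isomorphisms between corresponding parts can be added up.\<close>

lemma glue_left_inverse:
  assumes s1: "poly_action s1" and s2: "poly_action s2"
    and W1: "module.subspace s1 W1" and W2: "module.subspace s2 W2"
    and F: "finite F"
    and fix1: "\<And>f w. f \<in> F \<Longrightarrow> w \<in> W1 \<Longrightarrow> \<exists>k. s1 (f ^ k) (s1 (e f) w) = 0"
    and sum1: "\<And>w. w \<in> W1 \<Longrightarrow> (\<Sum>f\<in>F. s1 (e f) w) = w"
    and id2: "\<And>f w k. f \<in> F \<Longrightarrow> w \<in> W2 \<Longrightarrow> s2 (f ^ k) w = 0 \<Longrightarrow> s2 (e f) w = w"
    and ann2: "\<And>f h w k. f \<in> F \<Longrightarrow> w \<in> W2 \<Longrightarrow> h \<in> F \<Longrightarrow> f \<noteq> h \<Longrightarrow> s2 (f ^ k) w = 0 \<Longrightarrow> s2 (e h) w = 0"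
    and \<phi>: "\<And>f w k. f \<in> F \<Longrightarrow> w \<in> W1 \<Longrightarrow> s1 (f ^ k) w = 0 \<Longrightarrow>
        \<phi> f w \<in> W2 \<and> (\<exists>k. s2 (f ^ k) (\<phi> f w) = 0) \<and> \<psi> f (\<phi> f w) = w"
    and w: "w \<in> W1"
  shows "(\<Sum>h\<in>F. \<psi> h (s2 (e h) (\<Sum>f\<in>F. \<phi> f (s1 (e f) w)))) = w"
proof -
  interpret s1: poly_action s1 by fact
  interpret s2: poly_action s2 by fact
  have part: "\<phi> f (s1 (e f) w) \<in> W2" "\<exists>k. s2 (f ^ k) (\<phi> f (s1 (e f) w)) = 0"
      "\<psi> f (\<phi> f (s1 (e f) w)) = s1 (e f) w" if f: "f \<in> F" for f
  proof -
    obtain k where "s1 (f ^ k) (s1 (e f) w) = 0"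
      using fix1[OF f w] by blast
    then show "\<phi> f (s1 (e f) w) \<in> W2" "\<exists>k. s2 (f ^ k) (\<phi> f (s1 (e f) w)) = 0"
      "\<psi> f (\<phi> f (s1 (e f) w)) = s1 (e f) w"
      using \<phi>[OF f s1.subspace_scale[OF W1 w]] by blast+
  qed
  have "s2 (e h) (\<Sum>f\<in>F. \<phi> f (s1 (e f) w)) = \<phi> h (s1 (e h) w)" if h: "h \<in> F" for h
  proof -
    have "s2 (e h) (\<phi> f (s1 (e f) w)) = (if f = h then \<phi> h (s1 (e h) w) else 0)" if f: "f \<in> F" for f
      using id2[OF h] ann2[OF f _ h] part[OF f] by metis
    then show ?thesis
      using h F by (simp add: s2.scale_sum_right)
  qed
  then show ?thesis
    using part(3) sum1[OF w] by simp
qed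

text \<open>The inverse of the glued map is glued from the inverses, and
  \<open>glue_left_inverse\<close> is applied in both directions. This calls for the same
  \<open>e f\<close> on both sides, hence for one product of prime powers killing both
  modules.\<close>

lemma glue_primary_isos:
  fixes s1 :: "'a::field poly \<Rightarrow> 'b::ab_group_add \<Rightarrow> 'b" and s2 :: "'a poly \<Rightarrow> 'c::ab_group_add \<Rightarrow> 'c"
  assumes s1: "poly_action s1" and s2: "poly_action s2"
    and W1: "module.subspace s1 W1" and W2: "module.subspace s2 W2"
    and F: "finite F" "\<And>f. f \<in> F \<Longrightarrow> irreducible f \<and> lead_coeff f = 1"
    and kill1: "\<And>w. w \<in> W1 \<Longrightarrow> s1 (\<Prod>f\<in>F. f ^ m f) w = 0"
    and kill2: "\<And>w. w \<in> W2 \<Longrightarrow> s2 (\<Prod>f\<in>F. f ^ m f) w = 0"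
    and iso: "\<And>f. f \<in> F \<Longrightarrow> \<exists>\<phi>. module_iso \<phi> (submodule_record s1 {w \<in> W1. \<exists>k. s1 (f ^ k) w = 0})
        (submodule_record s2 {w \<in> W2. \<exists>k. s2 (f ^ k) w = 0})"
  shows "\<exists>\<Phi>. module_iso \<Phi> (submodule_record s1 W1) (submodule_record s2 W2)"
proof -
  interpret s1: poly_action s1 by fact
  interpret s2: poly_action s2 by fact
  let ?P1 = "\<lambda>f. {w \<in> W1. \<exists>k. s1 (f ^ k) w = 0}" and ?P2 = "\<lambda>f. {w \<in> W2. \<exists>k. s2 (f ^ k) w = 0}"
  have comax: "comaximal (f ^ k) (h ^ l)" if "f \<in> F" "h \<in> F" "f \<noteq> h" for f h k l
    using F(2) that by (intro comaximal_powers monic_irreducible_comaximal) auto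
  obtain e where e: "(\<forall>f\<in>F. f ^ m f dvd e f - 1) \<and> (\<forall>f\<in>F. \<forall>h\<in>F. f \<noteq> h \<longrightarrow> f ^ m f dvd e h) \<and>
      (\<forall>f\<in>F. (\<Prod>f\<in>F. f ^ m f) dvd f ^ m f * e f)"
    using comaximal_idempotents[of F "\<lambda>f. f ^ m f", OF F(1) comax] by (rule exE)
  have e1: "f ^ m f dvd e f - 1" and eP: "(\<Prod>f\<in>F. f ^ m f) dvd f ^ m f * e f" if "f \<in> F" for f
    using e that by simp_all
  have e0: "f ^ m f dvd e h" if "f \<in> F" "h \<in> F" "f \<noteq> h" for f h
    using e that by simp
  \<comment> \<open>The sum is 1 modulo each prime power, hence modulo the product, so the
    \<open>e f\<close> add up to the identity on a module killed by the product.\<close>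
  have "(\<Prod>f\<in>F. f ^ m f) dvd (\<Sum>f\<in>F. e f) - 1"
  proof (rule comaximal_prod_dvd[OF F(1)])
    fix f assume f: "f \<in> F"
    have "(\<Sum>f\<in>F. e f) - 1 = (e f - 1) + (\<Sum>h\<in>F - {f}. e h)"
      using F(1) f by (simp add: sum.remove)
    moreover have "f ^ m f dvd (\<Sum>h\<in>F - {f}. e h)"
      using e0[OF f] by (intro dvd_sum) auto
    ultimately show "f ^ m f dvd (\<Sum>f\<in>F. e f) - 1"
      using e1[OF f] by (simp only: dvd_add)
  qed (use comax in auto)
  then obtain r where "(\<Sum>f\<in>F. e f) - 1 = (\<Prod>f\<in>F. f ^ m f) * r"
    by (rule dvdE)
  then have r: "(\<Sum>f\<in>F. e f) = 1 + r * (\<Prod>f\<in>F. f ^ m f)"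
    by (simp add: diff_eq_eq mult.commute)
  \<comment> \<open>Polymorphic in the underlying group \<open>'d\<close>, so that it can be
    instantiated to both modules.\<close>
  have facts: "(\<forall>f\<in>F. \<forall>w\<in>W. s (f ^ m f) (s (e f) w) = 0) \<and>
      (\<forall>w\<in>W. (\<Sum>f\<in>F. s (e f) w) = w) \<and>
      (\<forall>f\<in>F. \<forall>w\<in>W. \<forall>k. s (f ^ k) w = 0 \<longrightarrow> s (e f) w = w) \<and>
      (\<forall>f\<in>F. \<forall>h\<in>F. \<forall>w\<in>W. \<forall>k. f \<noteq> h \<longrightarrow> s (f ^ k) w = 0 \<longrightarrow> s (e h) w = 0)"
    if s: "poly_action s" and kill: "\<And>w. w \<in> W \<Longrightarrow> s (\<Prod>f\<in>F. f ^ m f) w = 0"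
    for s :: "'a poly \<Rightarrow> 'd::ab_group_add \<Rightarrow> 'd" and W
  proof -
    interpret s: poly_action s by fact
    have dvd: "s q w = 0" if "p dvd q" "s p w = 0" for p q w
    proof -
      from that(1) obtain t where "q = p * t" by (rule dvdE)
      then have "s q w = s t (s p w)" by (simp add: mult.commute)
      then show ?thesis by (simp only: that(2) s.scale_zero_right)
    qed
    have A: "s (f ^ m f) (s (e f) w) = 0" if "f \<in> F" "w \<in> W" for f w
      using dvd[OF eP kill] that by simp
    have B: "(\<Sum>f\<in>F. s (e f) w) = w" if "w \<in> W" for w
      using kill[OF that] by (simp add: r s.scale_left_distrib flip: s.scale_sum_left s.scale_scale)
    \<comment> \<open>Any power of \<open>f\<close> killing \<open>w\<close> may be replaced by
      \<open>f ^ m f\<close>, since the remaining factors of the product are comaximal to every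
      power of \<open>f\<close>.\<close>
    have low: "s (f ^ m f) w = 0" if f: "f \<in> F" and w: "w \<in> W" and k: "s (f ^ k) w = 0" for f w k
    proof -
      let ?Q = "\<Prod>h\<in>F - {f}. h ^ m h"
      have "comaximal (f ^ k) ?Q"
        using comax f by (intro comaximal_prod_right) auto
      then obtain a b where ab: "a * f ^ k + b * ?Q = 1"
        unfolding comaximal_def by blast
      have "(\<Prod>f\<in>F. f ^ m f) = f ^ m f * ?Q"
        using F(1) f by (rule prod.remove)
      then have 0: "s (f ^ m f * ?Q) w = 0"
        using kill[OF w] by simp
      have "s (f ^ m f) w = s (f ^ m f * (a * f ^ k + b * ?Q)) w"
        by (simp add: ab)
      also have "\<dots> = s (f ^ m f * a) (s (f ^ k) w) + s b (s (f ^ m f * ?Q) w)"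
        by (simp add: algebra_simps)
      finally show ?thesis
        by (simp only: 0 k s.scale_zero_right add_0)
    qed
    have C: "s (e f) w = w" if "f \<in> F" "w \<in> W" "s (f ^ k) w = 0" for f w k
      using dvd[OF e1 low[OF that]] that(1) by (simp add: s.scale_left_diff_distrib)
    have D: "s (e h) w = 0" if "f \<in> F" "h \<in> F" "f \<noteq> h" "w \<in> W" "s (f ^ k) w = 0" for f h w k
      using dvd[OF e0 low] that by blast
    show ?thesis
      by (intro conjI ballI allI impI) (fact A | fact B | fact C | blast intro: D)+
  qed
  have facts1: "\<exists>k. s1 (f ^ k) (s1 (e f) w) = 0" "s1 (f ^ k) w = 0 \<Longrightarrow> s1 (e f) w = w"
      "h \<in> F \<Longrightarrow> f \<noteq> h \<Longrightarrow> s1 (f ^ k) w = 0 \<Longrightarrow> s1 (e h) w = 0"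
    if "f \<in> F" "w \<in> W1" for f h w k
    using facts[of s1 W1, OF s1 kill1] that by blast+
  have sum1: "(\<Sum>f\<in>F. s1 (e f) w) = w" if "w \<in> W1" for w
    using facts[of s1 W1, OF s1 kill1] that by blast
  have facts2: "\<exists>k. s2 (f ^ k) (s2 (e f) w) = 0" "s2 (f ^ k) w = 0 \<Longrightarrow> s2 (e f) w = w"
      "h \<in> F \<Longrightarrow> f \<noteq> h \<Longrightarrow> s2 (f ^ k) w = 0 \<Longrightarrow> s2 (e h) w = 0"
    if "f \<in> F" "w \<in> W2" for f h w k
    using facts[of s2 W2, OF s2 kill2] that by blast+
  have sum2: "(\<Sum>f\<in>F. s2 (e f) w) = w" if "w \<in> W2" for w
    using facts[of s2 W2, OF s2 kill2] that by blast
  have "\<exists>\<phi>. \<forall>f\<in>F. module_iso (\<phi> f) (submodule_record s1 (?P1 f)) (submodule_record s2 (?P2 f))"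
    by (intro bchoice ballI iso)
  then obtain \<phi> where \<phi>: "\<And>f. f \<in> F \<Longrightarrow> module_iso (\<phi> f) (submodule_record s1 (?P1 f)) (submodule_record s2 (?P2 f))"
    by blast
  define \<psi> where "\<psi> f = inv_into (?P1 f) (\<phi> f)" for f
  have bij: "bij_betw (\<phi> f) (?P1 f) (?P2 f)" if "f \<in> F" for f
    using \<phi>[OF that] by (simp add: module_iso_def)
  have add: "\<phi> f (x + y) = \<phi> f x + \<phi> f y" if "f \<in> F" "x \<in> ?P1 f" "y \<in> ?P1 f" for f x y
    using \<phi>[OF that(1)] that(2,3) unfolding module_iso_def by simp
  have smult: "\<phi> f (s1 p x) = s2 p (\<phi> f x)" if "f \<in> F" "x \<in> ?P1 f" for f p x
    using \<phi>[OF that(1)] that(2) unfolding module_iso_def by simp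
  have \<phi>in: "\<phi> f w \<in> ?P2 f \<and> \<psi> f (\<phi> f w) = w" if "f \<in> F" "w \<in> ?P1 f" for f w
    using bij_betw_apply[OF bij[OF that(1)] that(2)] bij_betw_inv_into_left[OF bij[OF that(1)] that(2)]
    unfolding \<psi>_def by blast
  have \<psi>in: "\<psi> f w \<in> ?P1 f \<and> \<phi> f (\<psi> f w) = w" if "f \<in> F" "w \<in> ?P2 f" for f w
    using bij_betw_apply[OF bij_betw_inv_into[OF bij[OF that(1)]] that(2)]
      bij_betw_inv_into_right[OF bij[OF that(1)] that(2)]
    unfolding \<psi>_def by blast
  define \<Phi> where "\<Phi> w = (\<Sum>f\<in>F. \<phi> f (s1 (e f) w))" for w
  define \<Psi> where "\<Psi> w = (\<Sum>f\<in>F. \<psi> f (s2 (e f) w))" for w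
  have e_in1: "s1 (e f) w \<in> ?P1 f" if "f \<in> F" "w \<in> W1" for f w
    using facts1(1)[OF that] s1.subspace_scale[OF W1 that(2)] by blast
  have e_in2: "s2 (e f) w \<in> ?P2 f" if "f \<in> F" "w \<in> W2" for f w
    using facts2(1)[OF that] s2.subspace_scale[OF W2 that(2)] by blast
  have "\<Psi> (\<Phi> w) = w" if "w \<in> W1" for w
    unfolding \<Phi>_def \<Psi>_def
    by (rule glue_left_inverse[OF s1 s2 W1 W2 F(1) facts1(1) sum1 facts2(2) facts2(3) _ that])
      (use \<phi>in in blast)+
  moreover have "\<Phi> (\<Psi> w) = w" if "w \<in> W2" for w
    unfolding \<Phi>_def \<Psi>_def
    by (rule glue_left_inverse[OF s2 s1 W2 W1 F(1) facts2(1) sum2 facts1(2) facts1(3) _ that])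
      (use \<psi>in in blast)+
  moreover have "\<Phi> w \<in> W2" if "w \<in> W1" for w
    unfolding \<Phi>_def using \<phi>in e_in1 that by (intro s2.subspace_sum[OF W2]) blast
  moreover have "\<Psi> w \<in> W1" if "w \<in> W2" for w
    unfolding \<Psi>_def using \<psi>in e_in2 that by (intro s1.subspace_sum[OF W1]) blast
  ultimately have "bij_betw \<Phi> W1 W2"
    by (intro bij_betw_byWitness[where f' = \<Psi>]) auto
  moreover have "\<Phi> (x + y) = \<Phi> x + \<Phi> y" if "x \<in> W1" "y \<in> W1" for x y
    unfolding \<Phi>_def s1.scale_right_distrib sum.distrib[symmetric]
    by (intro sum.cong refl add e_in1 that)
  moreover have "\<Phi> (s1 p x) = s2 p (\<Phi> x)" if "x \<in> W1" for p x
  proof -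
    have "\<phi> f (s1 (e f) (s1 p x)) = s2 p (\<phi> f (s1 (e f) x))" if "f \<in> F" for f
      using smult[OF that e_in1[OF that \<open>x \<in> W1\<close>], of p] by (simp add: mult.commute)
    then show ?thesis
      by (simp add: \<Phi>_def s2.scale_sum_right)
  qed
  ultimately show ?thesis
    by (intro exI[of _ \<Phi>]) (simp add: module_iso_def)
qed

section \<open>From module isomorphisms to similar matrices\<close>

lemma mat_op_mult:
  assumes "A \<in> carrier_mat n n" "B \<in> carrier_mat n n" "w \<in> coord_space n"
  shows "mat_op (A * B) w = mat_op A (mat_op B w)"
proof -
  obtain v where v: "v \<in> carrier_vec n" "w = vec_fun v"
    using bij_betw_vec_fun assms(3) by (metis bij_betw_imp_surj_on imageE)
  have "mat_op (A * B) w = vec_fun ((A * B) *\<^sub>v v)"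
    using vec_fun_mult_mat_vec[of "A * B" n v] assms v by simp
  also have "(A * B) *\<^sub>v v = A *\<^sub>v (B *\<^sub>v v)"
    using assms v by (simp add: assoc_mult_mat_vec[of _ n n _ n])
  also have "vec_fun \<dots> = mat_op A (mat_op B w)"
    using assms v by (simp add: vec_fun_mult_mat_vec[of _ n])
  finally show ?thesis .
qed

lemma mat_op_unit_fun:
  assumes "A \<in> carrier_mat n n" "i < n" "j < n"
  shows "mat_op A (unit_fun j) i = A $$ (i, j)"
  using assms by (simp add: mat_op_def unit_fun_def if_distrib cong: if_cong)

lemma mat_op_in_coord_space: "A \<in> carrier_mat n n \<Longrightarrow> mat_op A w \<in> coord_space n"
  by (auto simp: mat_op_def coord_space_def)

lemma mat_eq_if_mat_op_eq:
  assumes "A \<in> carrier_mat n n" "B \<in> carrier_mat n n"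
    and "\<And>w. w \<in> coord_space n \<Longrightarrow> mat_op A w = mat_op B w"
  shows "A = B"
proof (rule eq_matI)
  fix i j assume "i < dim_row B" "j < dim_col B"
  then show "A $$ (i, j) = B $$ (i, j)"
    using assms mat_op_unit_fun[of A n i j] mat_op_unit_fun[of B n i j]
      assms(3)[OF unit_fun_in_coord_space[of j n]] by simp
qed (use assms in auto)

lemma mat_op_one: "w \<in> coord_space n \<Longrightarrow> mat_op (1\<^sub>m n) w = w"
  by (auto simp: mat_op_def coord_space_def fun_eq_iff if_distrib[of "\<lambda>x. x * _"] not_less cong: if_cong)

text \<open>Linearity is known on \<open>coord_space n\<close> only, so the induction over partial
  sums of the expansion into unit vectors carries membership along.\<close>

lemma linear_map_as_mat_op:
  fixes L :: "(nat \<Rightarrow> 'a::field) \<Rightarrow> nat \<Rightarrow> 'a"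
  assumes add: "\<And>x y. x \<in> coord_space n \<Longrightarrow> y \<in> coord_space n \<Longrightarrow> L (x + y) = L x + L y"
    and scale: "\<And>c x. x \<in> coord_space n \<Longrightarrow> L (fun_scale c x) = fun_scale c (L x)"
    and into: "\<And>x. x \<in> coord_space n \<Longrightarrow> L x \<in> coord_space n"
  obtains A where "A \<in> carrier_mat n n" "\<And>w. w \<in> coord_space n \<Longrightarrow> mat_op A w = L w"
proof
  define A where "A = mat n n (\<lambda>(i, j). L (unit_fun j) i)"
  show "A \<in> carrier_mat n n" by (simp add: A_def)
  fix w :: "nat \<Rightarrow> 'a" assume w: "w \<in> coord_space n"
  have z: "(0 :: nat \<Rightarrow> 'a) \<in> coord_space n" by (simp add: coord_space_def)
  have L0: "L 0 = 0" using add[OF z z] by simp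
  have sum: "(\<Sum>j\<in>J. fun_scale (w j) (unit_fun j)) \<in> coord_space n \<and>
      L (\<Sum>j\<in>J. fun_scale (w j) (unit_fun j)) = (\<Sum>j\<in>J. fun_scale (w j) (L (unit_fun j)))"
    if "J \<subseteq> {..<n}" for J
    using finite_subset[OF that finite_lessThan] that
  proof (induction J rule: finite_induct)
    case (insert j J)
    then have IH: "(\<Sum>j\<in>J. fun_scale (w j) (unit_fun j)) \<in> coord_space n"
      "L (\<Sum>j\<in>J. fun_scale (w j) (unit_fun j)) = (\<Sum>j\<in>J. fun_scale (w j) (L (unit_fun j)))"
      by simp_all
    have "fun_scale (w j) (unit_fun j) \<in> coord_space n"
      using insert.prems by (auto simp: coord_space_def fun_scale_def unit_fun_def)
    moreover have "(unit_fun j :: nat \<Rightarrow> 'a) \<in> coord_space n"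
      using insert.prems by (simp add: unit_fun_in_coord_space)
    moreover have "x + y \<in> coord_space n" if "x \<in> coord_space n" "y \<in> coord_space n"
      for x y :: "nat \<Rightarrow> 'a"
      using that by (simp add: coord_space_def)
    ultimately show ?case
      unfolding sum.insert[OF insert.hyps] using IH
      by (subst add) (simp_all only: scale simp_thms)
  qed (simp add: z L0)
  have "w = (\<Sum>j<n. fun_scale (w j) (unit_fun j))"
    by (rule coord_space_expansion[OF w])
  then have "L w = (\<Sum>j<n. fun_scale (w j) (L (unit_fun j)))"
    using sum[of "{..<n}"] by simp
  moreover have "mat_op A w i = (\<Sum>j<n. fun_scale (w j) (L (unit_fun j))) i" for i
  proof (cases "i < n")
    case True
    then show ?thesis
      by (simp add: mat_op_def A_def sum_fun_apply fun_scale_def mult.commute)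
  next
    case False
    then have "L (unit_fun j) i = 0" if "j < n" for j
      using into[OF unit_fun_in_coord_space[OF that]] by (simp add: coord_space_def)
    then show ?thesis
      using False by (simp add: mat_op_def A_def sum_fun_apply fun_scale_def)
  qed
  ultimately show "mat_op A w = L w" by auto
qed

text \<open>Compatibility with constants makes the isomorphism linear over the field, compatibility
  with \<open>[:0, 1:]\<close> makes it intertwine \<open>M\<close> and \<open>N\<close>. It and its
  inverse are given by matrices \<open>P\<close> and \<open>Q\<close> with
  \<open>M = Q * N * P\<close>; the sizes agree by counting elements.\<close>

lemma similar_if_module_iso:
  fixes M N :: "'a::{field, finite} mat"
  assumes M: "M \<in> carrier_mat n n" and N: "N \<in> carrier_mat m m"
    and iso: "module_iso \<Phi> (submodule_record (mat_action M) (coord_space n))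
      (submodule_record (mat_action N) (coord_space m))"
  shows "similar_mat M N"
proof -
  have bij: "bij_betw \<Phi> (coord_space n) (coord_space m)"
    and add: "\<And>x y. x \<in> coord_space n \<Longrightarrow> y \<in> coord_space n \<Longrightarrow> \<Phi> (x + y) = \<Phi> x + \<Phi> y"
    and smult: "\<And>p x. x \<in> coord_space n \<Longrightarrow> \<Phi> (mat_action M p x) = mat_action N p (\<Phi> x)"
    using iso by (simp_all add: module_iso_def)
  have VM: "mat.action.subspace M (coord_space n)"
    using M by (auto intro: subspace_coord_space)
  have inv: "module_iso (inv_into (coord_space n) \<Phi>) (submodule_record (mat_action N) (coord_space m))
      (submodule_record (mat_action M) (coord_space n))"
    using module_iso_inv[OF iso] mat.action.subspace_add[OF VM] mat.action.subspace_scale[OF VM] by simp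
  let ?\<Psi> = "inv_into (coord_space n) \<Phi>"
  have add': "\<And>x y. x \<in> coord_space m \<Longrightarrow> y \<in> coord_space m \<Longrightarrow> ?\<Psi> (x + y) = ?\<Psi> x + ?\<Psi> y"
    and smult': "\<And>p x. x \<in> coord_space m \<Longrightarrow> ?\<Psi> (mat_action N p x) = mat_action M p (?\<Psi> x)"
    using inv by (simp_all add: module_iso_def)
  have "card (UNIV :: 'a set) ^ n = card (UNIV :: 'a set) ^ m"
    using bij_betw_same_card[OF bij] by (simp add: card_coord_space)
  moreover have "card (UNIV :: 'a set) > 1"
    using card_mono[of UNIV "{0, 1 :: 'a}"] by simp
  ultimately have "n = m" by simp
  have into: "\<Phi> x \<in> coord_space n" "?\<Psi> x \<in> coord_space n" if "x \<in> coord_space n" for x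
    using bij bij_betw_inv_into[OF bij] that unfolding \<open>n = m\<close> by (auto dest: bij_betwE)
  have sc: "\<Phi> (fun_scale c x) = fun_scale c (\<Phi> x)" "?\<Psi> (fun_scale c x) = fun_scale c (?\<Psi> x)"
    if "x \<in> coord_space n" for c x
    using smult[of x "[:c:]"] smult'[of x "[:c:]"] that \<open>n = m\<close> by (simp_all add: mat.poly_apply_const)
  obtain P where P: "P \<in> carrier_mat n n" "\<And>w. w \<in> coord_space n \<Longrightarrow> mat_op P w = \<Phi> w"
    using linear_map_as_mat_op[of n \<Phi>] add sc(1) into(1) by blast
  obtain Q where Q: "Q \<in> carrier_mat n n" "\<And>w. w \<in> coord_space n \<Longrightarrow> mat_op Q w = ?\<Psi> w"
    using linear_map_as_mat_op[of n ?\<Psi>] add' sc(2) into(2) \<open>n = m\<close> by blast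
  have N': "N \<in> carrier_mat n n" using N \<open>n = m\<close> by simp
  have \<Phi>\<Psi>: "\<Phi> (?\<Psi> w) = w" "?\<Psi> (\<Phi> w) = w" if "w \<in> coord_space n" for w
    using bij that \<open>n = m\<close> by (auto simp: bij_betw_inv_into_left bij_betw_inv_into_right)
  have "P * Q = 1\<^sub>m n"
    using P Q into by (intro mat_eq_if_mat_op_eq[of _ n]) (auto simp: mat_op_mult mat_op_one \<Phi>\<Psi>)
  moreover have "Q * P = 1\<^sub>m n"
    using P Q into by (intro mat_eq_if_mat_op_eq[of _ n]) (auto simp: mat_op_mult mat_op_one \<Phi>\<Psi>)
  moreover have "M = Q * N * P"
  proof (rule mat_eq_if_mat_op_eq[OF M])
    show "Q * N * P \<in> carrier_mat n n" using P Q N' by simp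
    fix w :: "nat \<Rightarrow> 'a" assume w: "w \<in> coord_space n"
    have "mat_op (Q * N * P) w = mat_op Q (mat_op N (\<Phi> w))"
      using P Q N' w into(1)[OF w] by (simp add: mat_op_mult[of _ n])
    also have "mat_op N (\<Phi> w) = \<Phi> (mat_op M w)"
      using smult[OF w, of "[:0, 1:]"] by (simp add: mat.poly_apply_X)
    finally show "mat_op M w = mat_op (Q * N * P) w"
      using Q(2) \<Phi>\<Psi> into mat_op_in_coord_space[OF M] by simp
  qed
  ultimately show ?thesis
    using M N' P(1) Q(1) by (intro similar_matI[of _ _ Q P n]) auto
qed

text \<open>By Cayley-Hamilton the product of both characteristic polynomials kills both modules;
  its factorization supplies the common prime powers for the gluing.\<close>

lemma similar_if_primary_isos:
  fixes M N :: "'a::{field, finite} mat"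
  assumes M: "M \<in> carrier_mat n n" and N: "N \<in> carrier_mat m m"
    and iso: "\<And>f. irreducible f \<Longrightarrow> lead_coeff f = 1 \<Longrightarrow>
      \<exists>\<phi>. module_iso \<phi> (submodule_record (mat_action M) (primary_space M f))
        (submodule_record (mat_action N) (primary_space N f))"
  shows "similar_mat M N"
proof -
  have "monic (char_poly M * char_poly N)"
    using degree_monic_char_poly[OF M] degree_monic_char_poly[OF N] by (simp add: lead_coeff_mult)
  then obtain F k where F: "finite F" "char_poly M * char_poly N = (\<Prod>f\<in>F. f ^ Suc (k f))"
      "F \<subseteq> {f. irreducible f \<and> monic f}"
    using monic_irreducible_factorization by blast
  have "\<exists>\<Phi>. module_iso \<Phi> (submodule_record (mat_action M) (coord_space n))
      (submodule_record (mat_action N) (coord_space m))"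
  proof (rule glue_primary_isos[OF _ _ _ _ F(1), where m = "\<lambda>f. Suc (k f)"])
    show "mat_action M (\<Prod>f\<in>F. f ^ Suc (k f)) w = 0" if "w \<in> coord_space n" for w
      unfolding F(2)[symmetric] mult.commute[of "char_poly M"] mat.poly_apply_mult
        cayley_hamilton_action[OF M that]
      by (rule mat.action.scale_zero_right)
    show "mat_action N (\<Prod>f\<in>F. f ^ Suc (k f)) w = 0" if "w \<in> coord_space m" for w
      unfolding F(2)[symmetric] mat.poly_apply_mult cayley_hamilton_action[OF N that]
      by (rule mat.action.scale_zero_right)
    show "\<exists>\<phi>. module_iso \<phi> (submodule_record (mat_action M) {w \<in> coord_space n. \<exists>k. mat_action M (f ^ k) w = 0})
        (submodule_record (mat_action N) {w \<in> coord_space m. \<exists>k. mat_action N (f ^ k) w = 0})"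
      if "f \<in> F" for f
      using iso[of f] F(3) that M N by (auto simp: primary_space_def)
  qed (use M N F(3) in \<open>auto intro: subspace_coord_space mat.action.poly_action_axioms\<close>)
  then show ?thesis
    using similar_if_module_iso[OF M N] by blast
qed

section \<open>Substitutions between irreducible polynomials over a finite field\<close>

text \<open>For a root \<open>\<alpha>\<close> of an irreducible \<open>f\<close> the image is a
  copy of K[x]/(f). All these copies lie in one algebraic closure, where they can be compared as
  sets.\<close>

definition ac_eval :: "'a::field alg_closure \<Rightarrow> 'a poly \<Rightarrow> 'a alg_closure" where
  "ac_eval \<alpha> p = poly (map_poly to_ac p) \<alpha>"

lemma ac_eval_0 [simp]: "ac_eval \<alpha> 0 = 0"
  by (simp add: ac_eval_def)

lemma ac_eval_pCons [simp]: "ac_eval \<alpha> (pCons a p) = to_ac a + \<alpha> * ac_eval \<alpha> p"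
  by (simp add: ac_eval_def Polynomial.map_poly_pCons)

lemma ac_eval_1 [simp]: "ac_eval \<alpha> 1 = 1"
  by (simp add: one_pCons)

lemma ac_eval_add [simp]: "ac_eval \<alpha> (p + q) = ac_eval \<alpha> p + ac_eval \<alpha> q"
proof (induction p arbitrary: q)
  case (pCons a p)
  obtain b r where "q = pCons b r" by (rule pCons_cases)
  then show ?case by (simp add: pCons algebra_simps)
qed simp

lemma ac_eval_smult [simp]: "ac_eval \<alpha> (Polynomial.smult a p) = to_ac a * ac_eval \<alpha> p"
  by (induction p) (simp_all add: algebra_simps)

lemma ac_eval_mult [simp]: "ac_eval \<alpha> (p * q) = ac_eval \<alpha> p * ac_eval \<alpha> q"
  by (induction p) (simp_all add: algebra_simps)

lemma ac_eval_uminus [simp]: "ac_eval \<alpha> (- p) = - ac_eval \<alpha> p"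
  by (induction p) (simp_all add: algebra_simps)

lemma ac_eval_diff [simp]: "ac_eval \<alpha> (p - q) = ac_eval \<alpha> p - ac_eval \<alpha> q"
  using ac_eval_add[of \<alpha> p "- q"] by simp

lemma ac_eval_pcompose: "ac_eval \<alpha> (pcompose p g) = ac_eval (ac_eval \<alpha> g) p"
  by (induction p) (simp_all add: pcompose_pCons)

lemma irreducible_degree_pos:
  fixes f :: "'a::field poly"
  assumes "irreducible f"
  shows "degree f > 0"
proof (rule ccontr)
  assume "\<not> degree f > 0"
  then show False
    using assms by (auto simp: Factorial_Ring.irreducible_def is_unit_iff_degree)
qed

lemma irreducible_has_ac_root:
  fixes f :: "'a::field poly"
  assumes "irreducible f"
  obtains \<alpha> where "ac_eval \<alpha> f = 0"
proof -
  have "degree (map_poly to_ac f) > 0"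
    using irreducible_degree_pos[OF assms] by (simp add: degree_map_poly)
  then obtain \<alpha> where "poly (map_poly to_ac f) \<alpha> = 0"
    using alg_closed_imp_poly_has_root by blast
  then show thesis
    using that by (simp add: ac_eval_def)
qed

text \<open>A Bezout identity for \<open>f\<close> and a \<open>p\<close> not divisible by it,
  evaluated at a common root, would read 0 = 1.\<close>

lemma ac_eval_eq_0_iff:
  fixes f :: "'a::field poly"
  assumes "irreducible f" "ac_eval \<alpha> f = 0"
  shows "ac_eval \<alpha> p = 0 \<longleftrightarrow> f dvd p"
proof
  assume 0: "ac_eval \<alpha> p = 0"
  show "f dvd p"
  proof (rule ccontr)
    assume "\<not> f dvd p"
    then obtain u v where "u * f + v * p = 1"
      using irreducible_comaximal[OF assms(1)] unfolding comaximal_def by blast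
    then have "ac_eval \<alpha> (u * f + v * p) = 1" by simp
    then show False using 0 assms(2) by simp
  qed
qed (use assms(2) in auto)

section \<open>Fields generated by roots: size, Frobenius and separability\<close>

lemma card_range_ac_eval:
  fixes f :: "'a::{field, finite} poly"
  assumes f: "irreducible f" "ac_eval \<alpha> f = 0"
  shows "card (range (ac_eval \<alpha>)) = CARD('a) ^ degree f" "finite (range (ac_eval \<alpha>))"
proof -
  let ?S = "{p :: 'a poly. \<forall>i\<ge>degree f. coeff p i = 0}"
  have "f \<noteq> 0" using f(1) by auto
  have eq: "range (ac_eval \<alpha>) = ac_eval \<alpha> ` ?S"
  proof -
    have "ac_eval \<alpha> p \<in> ac_eval \<alpha> ` ?S" for p
    proof (rule image_eqI)
      have "ac_eval \<alpha> (p div f * f + p mod f) = ac_eval \<alpha> (p mod f)"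
        unfolding ac_eval_add ac_eval_mult using f(2) by simp
      then show "ac_eval \<alpha> p = ac_eval \<alpha> (p mod f)" by simp
      show "p mod f \<in> ?S"
        unfolding mem_Collect_eq coeff_bounded_iff_degree_less
        by (rule degree_mod_less) fact
    qed
    then show ?thesis by blast
  qed
  have "inj_on (ac_eval \<alpha>) ?S"
  proof (rule inj_onI)
    fix p q assume "p \<in> ?S" "q \<in> ?S" "ac_eval \<alpha> p = ac_eval \<alpha> q"
    moreover from this have "f dvd p - q"
      using ac_eval_eq_0_iff[OF f, of "p - q"] by simp
    ultimately show "p = q"
      using bounded_dvd_diff_imp_eq by blast
  qed
  then show "card (range (ac_eval \<alpha>)) = CARD('a) ^ degree f" "finite (range (ac_eval \<alpha>))"
    unfolding eq by (simp_all add: card_image card_polys_bounded finite_polys_bounded)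
qed

text \<open>As in Fermat's little theorem, multiplication by a nonzero \<open>z\<close> permutes the
  nonzero elements of \<open>A\<close>; comparing their products gives
  \<open>z ^ (card A - 1) = 1\<close>.\<close>

lemma finite_mult_closed_power_card:
  fixes A :: "'b::field set"
  assumes "finite A" "0 \<in> A" "\<And>x y. x \<in> A \<Longrightarrow> y \<in> A \<Longrightarrow> x * y \<in> A" "z \<in> A"
  shows "z ^ card A = z"
proof (cases "z = 0")
  case True
  have "card A \<noteq> 0" using assms(1,2) by auto
  then show ?thesis using True by simp
next
  case False
  let ?B = "A - {0}"
  have inj: "inj_on ((*) z) ?B"
    using False by (auto intro: inj_onI)
  have "(*) z ` ?B \<subseteq> ?B"
    using assms(3,4) False by auto
  then have im: "(*) z ` ?B = ?B"
    using inj assms(1) by (intro card_subset_eq) (auto simp: card_image)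
  have "prod id ?B = prod id ((*) z ` ?B)"
    by (simp only: im)
  also have "\<dots> = (\<Prod>b\<in>?B. z * b)"
    by (simp add: prod.reindex[OF inj])
  also have "\<dots> = z ^ card ?B * prod id ?B"
    by (simp add: prod.distrib)
  finally have "z ^ card ?B = 1"
    using assms(1) by simp
  moreover have "card A = Suc (card ?B)"
    using card_Suc_Diff1[OF assms(1,2)] by simp
  ultimately show ?thesis by simp
qed

lemma ac_eval_power_card:
  fixes f :: "'a::{field, finite} poly"
  assumes f: "irreducible f" "ac_eval \<alpha> f = 0"
  shows "ac_eval \<alpha> p ^ (CARD('a) ^ degree f) = ac_eval \<alpha> p"
proof -
  have "ac_eval \<alpha> x * ac_eval \<alpha> y \<in> range (ac_eval \<alpha>)" for x y
    by (metis ac_eval_mult rangeI)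
  moreover have "0 \<in> range (ac_eval \<alpha>)"
    by (metis ac_eval_0 rangeI)
  ultimately show ?thesis
    using finite_mult_closed_power_card[of "range (ac_eval \<alpha>)" "ac_eval \<alpha> p"] card_range_ac_eval[OF f] by auto
qed

lemma card_field_power_gt_1:
  assumes "d > 0"
  shows "CARD('a::{field, finite}) ^ d > 1"
proof -
  have "CARD('a) > 1"
    using card_mono[of UNIV "{0, 1 :: 'a}"] by simp
  then show ?thesis using assms by (rule one_less_power)
qed

text \<open>All q^d elements of the field generated by the root satisfy the equation, and a
  polynomial of degree q^d has no further roots. The right side depends on \<open>f\<close> only
  through its degree: fields of equal order become equal sets.\<close>

lemma range_ac_eval:
  fixes f :: "'a::{field, finite} poly"
  assumes f: "irreducible f" "ac_eval \<alpha> f = 0"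
  shows "range (ac_eval \<alpha>) = {z. z ^ (CARD('a) ^ degree f) = z}"
proof -
  let ?Q = "CARD('a) ^ degree f"
  define P :: "'a alg_closure poly" where "P = monom 1 ?Q - monom 1 1"
  have Q: "?Q > 1"
    by (rule card_field_power_gt_1[OF irreducible_degree_pos[OF f(1)]])
  have "coeff P ?Q = 1" using Q by (simp add: P_def)
  then have "P \<noteq> 0" by auto
  have "degree P \<le> ?Q"
    unfolding P_def using Q by (intro degree_diff_le) (auto intro: order_trans[OF degree_monom_le])
  have roots: "{z. poly P z = 0} = {z. z ^ ?Q = z}"
    by (simp add: P_def poly_monom)
  have "finite {z. poly P z = 0}" "card {z. poly P z = 0} \<le> ?Q"
    using poly_roots_finite[OF \<open>P \<noteq> 0\<close>] card_poly_roots_bound[OF \<open>P \<noteq> 0\<close>] \<open>degree P \<le> ?Q\<close> by auto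
  moreover have "range (ac_eval \<alpha>) \<subseteq> {z. z ^ ?Q = z}"
    using ac_eval_power_card[OF f] by auto
  ultimately show ?thesis
    using card_range_ac_eval[OF f] by (intro card_seteq) (auto simp: roots)
qed

text \<open>Translation by 1 permutes the field and leaves the sum of all elements
  unchanged.\<close>

lemma of_nat_card_field: "of_nat CARD('a) = (0 :: 'a::{field, finite})"
proof -
  have "(\<Sum>a\<in>UNIV. a + 1) = (\<Sum>a\<in>UNIV. a :: 'a)"
    by (rule sum.reindex_bij_betw) (auto intro: bij_betwI[where g = "\<lambda>a. a - 1"])
  then show ?thesis by (simp add: sum.distrib)
qed

text \<open>Separability: \<open>f\<close> divides x^(q^d) - x, whose derivative is -1, whereas at a
  common root of \<open>f\<close> and its derivative the derivative of every multiple of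
  \<open>f\<close> vanishes.\<close>

lemma ac_eval_pderiv_neq_0:
  fixes f :: "'a::{field, finite} poly"
  assumes f: "irreducible f" "ac_eval \<alpha> f = 0"
  shows "ac_eval \<alpha> (pderiv f) \<noteq> 0"
proof
  assume 0: "ac_eval \<alpha> (pderiv f) = 0"
  let ?Q = "CARD('a) ^ degree f"
  define P :: "'a poly" where "P = [:0, 1:] ^ ?Q - [:0, 1:]"
  have pow: "ac_eval \<alpha> (p ^ k) = ac_eval \<alpha> p ^ k" for p k
    by (induction k) simp_all
  have "ac_eval \<alpha> P = 0"
    using ac_eval_power_card[OF f, of "[:0, 1:]"] by (simp add: P_def pow)
  then have "f dvd P" using ac_eval_eq_0_iff[OF f] by blast
  then obtain w where w: "P = f * w" by (rule dvdE)
  have "pderiv P = - 1"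
    using irreducible_degree_pos[OF f(1)]
    by (simp add: P_def pderiv_diff pderiv_power pderiv_pCons one_pCons of_nat_card_field power_0_left)
  then have "ac_eval \<alpha> (pderiv (f * w)) = - 1"
    unfolding w[symmetric] by simp
  then show False
    using 0 f(2) by (simp add: pderiv_mult)
qed

text \<open>The first-order Taylor formula, by Horner's rule. It will show how the value at a root
  modulo f changes modulo f^2 when the root is moved by f.\<close>

lemma pcompose_taylor_1:
  fixes p g h :: "'a::idom poly"
  shows "h\<^sup>2 dvd pcompose p (g + h) - (pcompose p g + h * pcompose (pderiv p) g)"
proof (induction p)
  case (pCons a p)
  let ?r = "pcompose p (g + h) - (pcompose p g + h * pcompose (pderiv p) g)"
  have "pcompose (pCons a p) (g + h) - (pcompose (pCons a p) g + h * pcompose (pderiv (pCons a p)) g) =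
      (g + h) * ?r + h\<^sup>2 * pcompose (pderiv p) g"
    by (simp add: pcompose_pCons pderiv_pCons pcompose_add algebra_simps power2_eq_square)
  then show ?case
    using pCons.IH by (metis dvd_add dvd_mult dvd_triv_left)
qed simp

text \<open>Congruent arguments give congruent values; this lets a substitution found modulo f^2
  survive the gluing.\<close>

lemma diff_dvd_pcompose_diff: "a - b dvd pcompose p a - pcompose p b"
  for p a b :: "'a::comm_ring_1 poly"
proof (induction p)
  case (pCons c p)
  have "pcompose (pCons c p) a - pcompose (pCons c p) b =
      (a - b) * pcompose p a + b * (pcompose p a - pcompose p b)"
    by (simp add: pcompose_pCons algebra_simps)
  then show ?case
    using pCons.IH by (metis dvd_add dvd_mult dvd_triv_left)
qed simp

text \<open>Finite fields of equal order are isomorphic, so \<open>h\<close> has a root in \<open>K[x]/(f)\<close>; a root modulo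
  \<open>f\<close> that happens to be a root modulo \<open>f\<^sup>2\<close> is moved by \<open>f\<close>, which works as \<open>h\<close> is separable.\<close>

lemma exists_uniformizing_substitution:
  fixes f h :: "'a::{field, finite} poly"
  assumes f: "irreducible f" and h: "irreducible h" and deg: "degree f = degree h"
  shows "\<exists>g. f dvd pcompose h g \<and> \<not> f\<^sup>2 dvd pcompose h g"
proof -
  obtain \<alpha> where \<alpha>: "ac_eval \<alpha> f = 0" using irreducible_has_ac_root[OF f] by blast
  obtain \<beta> where \<beta>: "ac_eval \<beta> h = 0" using irreducible_has_ac_root[OF h] by blast
  have "\<beta> = ac_eval \<beta> [:0, 1:]" by simp
  then have "\<beta> \<in> range (ac_eval \<beta>)" by (metis rangeI)
  \<comment> \<open>Both are the set of solutions of z^(q^d) = z. Hence the root of \<open>h\<close>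
    is a polynomial \<open>g\<close> in the root of \<open>f\<close>, which says that
    \<open>f\<close> divides h(g).\<close>
  also have "range (ac_eval \<beta>) = range (ac_eval \<alpha>)"
    unfolding range_ac_eval[OF f \<alpha>] range_ac_eval[OF h \<beta>] deg ..
  finally obtain g where g: "\<beta> = ac_eval \<alpha> g" by blast
  have dvd: "f dvd pcompose h g"
    using \<beta> by (simp add: g ac_eval_pcompose flip: ac_eval_eq_0_iff[OF f \<alpha>])
  show ?thesis
  proof (cases "f\<^sup>2 dvd pcompose h g")
    case False
    then show ?thesis using dvd by blast
  next
    case True
    let ?h = "pcompose h (g + f)"
    have t: "f\<^sup>2 dvd ?h - (pcompose h g + f * pcompose (pderiv h) g)"
      by (rule pcompose_taylor_1)
    have "f dvd ?h"
    proof -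
      have "(g + f) - g dvd ?h - pcompose h g"
        by (rule diff_dvd_pcompose_diff)
      then show ?thesis using dvd_add[OF _ dvd, of "?h - pcompose h g"] by simp
    qed
    moreover have "\<not> f\<^sup>2 dvd ?h"
    proof
      assume "f\<^sup>2 dvd ?h"
      \<comment> \<open>If the moved root were again a root modulo f^2, the first-order term would
        be divisible by f^2, making \<open>\<beta>\<close> a common root of \<open>h\<close> and its
        derivative.\<close>
      from dvd_diff[OF dvd_diff[OF this t] True] have "f\<^sup>2 dvd f * pcompose (pderiv h) g"
        by simp
      then have "f dvd pcompose (pderiv h) g"
        using f by (auto simp: power2_eq_square)
      then have "ac_eval \<beta> (pderiv h) = 0"
        by (simp add: g ac_eval_pcompose flip: ac_eval_eq_0_iff[OF f \<alpha>])
      then show False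
        using ac_eval_pderiv_neq_0[OF h \<beta>] by blast
    qed
    ultimately show ?thesis by blast
  qed
qed

section \<open>Similarity of matrices with equal class type\<close>

lemma module_isomorphic_primary_component:
  assumes "M \<in> carrier_mat n n"
  shows "module_isomorphic class_ring (primary_component M f) N \<longleftrightarrow>
    module_isomorphic class_ring (submodule_record (mat_action M) (primary_space M f)) N"
proof -
  note iso = module_iso_primary_component[OF assms, of f]
  note inv = module_iso_inv[OF iso closed_primary_component[OF assms]]
  show ?thesis
    unfolding module_isomorphic_iff by (blast intro: module_iso_trans[OF iso] module_iso_trans[OF inv])
qed

lemma kernel_in_primary_space:
  "dim_row M = n \<Longrightarrow> {w \<in> coord_space n. mat_action M (f ^ k) w = 0} =
    {w \<in> primary_space M f. mat_action M (f ^ k) w = 0}"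
  by (auto simp: primary_space_def)

lemma card_kernel_if_isomorphic_cyclic_sum:
  fixes M :: "'a::{field, finite} mat"
  assumes M: "M \<in> carrier_mat n n" and f: "irreducible f"
    and iso: "module_isomorphic class_ring (submodule_record (mat_action M) (primary_space M f)) (cyclic_sum f ks)"
  shows "card {w \<in> coord_space n. mat_action M (f ^ k) w = 0} =
    CARD('a) ^ (degree f * sum_list (map (min k) ks))"
proof -
  have "f \<noteq> 0" using f by auto
  then show ?thesis
    using card_kernel_cyclic_decomposition[OF mat.action.poly_action_axioms _ subspace_primary_space iso] M
    by (simp add: kernel_in_primary_space)
qed

lemma card_power_degree_inject:
  fixes f :: "'a::{field, finite} poly"
  assumes "irreducible f" "CARD('a) ^ (degree f * a) = CARD('a) ^ (degree f * b)"
  shows "a = b"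
proof -
  have "CARD('a) > 1"
    using card_field_power_gt_1[of 1, where ?'a = 'a] by simp
  then show ?thesis
    using assms irreducible_degree_pos[OF assms(1)] by simp
qed

text \<open>Makes the definite description in \<open>primary_partition\<close> meaningful: the
  structure theorem gives a partition, and the sizes of the kernels determine its truncated sums,
  hence the partition.\<close>

lemma primary_partition_spec:
  fixes M :: "'a::{field, finite} mat"
  assumes M: "M \<in> carrier_mat n n" and f: "irreducible f"
  shows "is_partition (primary_partition M f)"
    and "module_isomorphic class_ring (submodule_record (mat_action M) (primary_space M f))
      (cyclic_sum f (primary_partition M f))"
proof -
  let ?R = "submodule_record (mat_action M) (primary_space M f)"
  let ?P = "\<lambda>ks. is_partition ks \<and> module_isomorphic class_ring (primary_component M f) (cyclic_sum f ks)"
  have "finite (primary_space M f)"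
    by (rule finite_subset[OF _ finite_coord_space[of "dim_row M"]]) (auto simp: primary_space_def)
  then obtain ks where ks: "is_partition ks" "module_isomorphic class_ring ?R (cyclic_sum f ks)"
    using mat.action.primary_structure[OF f subspace_primary_space] by (auto simp: primary_space_def)
  have "ls = ks" if ls: "is_partition ls" "module_isomorphic class_ring ?R (cyclic_sum f ls)" for ls
  proof (rule partition_eq_if_truncated_sums_eq[OF ls(1) ks(1)])
    fix k
    have "CARD('a) ^ (degree f * sum_list (map (min k) ls)) = CARD('a) ^ (degree f * sum_list (map (min k) ks))"
      using card_kernel_if_isomorphic_cyclic_sum[OF M f ls(2), of k]
        card_kernel_if_isomorphic_cyclic_sum[OF M f ks(2), of k] by simp
    then show "sum_list (map (min k) ls) = sum_list (map (min k) ks)"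
      by (rule card_power_degree_inject[OF f])
  qed
  then have "\<exists>!ks. ?P ks"
    using ks unfolding module_isomorphic_primary_component[OF M] by blast
  then have "?P (primary_partition M f)"
    unfolding primary_partition_def by (rule theI')
  then show "is_partition (primary_partition M f)"
    and "module_isomorphic class_ring ?R (cyclic_sum f (primary_partition M f))"
    unfolding module_isomorphic_primary_component[OF M] by blast+
qed

lemma card_kernel_primary_partition:
  fixes M :: "'a::{field, finite} mat"
  assumes M: "M \<in> carrier_mat n n" and f: "irreducible f"
  shows "card {w \<in> coord_space n. mat_action M (f ^ k) w = 0} =
    CARD('a) ^ (degree f * sum_list (map (min k) (primary_partition M f)))"
  using card_kernel_if_isomorphic_cyclic_sum[OF M f primary_partition_spec(2)[OF M f]] .

lemma primary_partition_eqI: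
  fixes M N :: "'a::{field, finite} mat"
  assumes M: "M \<in> carrier_mat n n" and N: "N \<in> carrier_mat m m" and f: "irreducible f"
    and card: "\<And>k. card {w \<in> coord_space n. mat_action M (f ^ k) w = 0} =
      card {w \<in> coord_space m. mat_action N (f ^ k) w = 0}"
  shows "primary_partition M f = primary_partition N f"
proof (rule partition_eq_if_truncated_sums_eq)
  show "sum_list (map (min k) (primary_partition M f)) = sum_list (map (min k) (primary_partition N f))" for k
    using card[of k] unfolding card_kernel_primary_partition[OF M f] card_kernel_primary_partition[OF N f]
    by (rule card_power_degree_inject[OF f])
qed (use primary_partition_spec M N f in blast)+

text \<open>Equal sizes give equal partitions, so corresponding primary spaces are isomorphic to the
  same cyclic sum.\<close>

lemma similar_if_kernel_cards_eq:
  fixes M N :: "'a::{field, finite} mat"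
  assumes M: "M \<in> carrier_mat n n" and N: "N \<in> carrier_mat m m"
    and card: "\<And>f k. irreducible f \<Longrightarrow> lead_coeff f = 1 \<Longrightarrow>
      card {w \<in> coord_space n. mat_action M (f ^ k) w = 0} =
      card {w \<in> coord_space m. mat_action N (f ^ k) w = 0}"
  shows "similar_mat M N"
proof (rule similar_if_primary_isos[OF M N])
  fix f :: "'a poly" assume f: "irreducible f" "lead_coeff f = 1"
  let ?D = "cyclic_sum f (primary_partition M f)"
  obtain \<phi> where \<phi>: "module_iso \<phi> (submodule_record (mat_action M) (primary_space M f)) ?D"
    using primary_partition_spec(2)[OF M f(1)] by (auto simp: module_isomorphic_iff)
  have "primary_partition M f = primary_partition N f"
    using card[OF f] by (intro primary_partition_eqI[OF M N f(1)])
  then obtain \<psi> where \<psi>: "module_iso \<psi> (submodule_record (mat_action N) (primary_space N f)) ?D"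
    using primary_partition_spec(2)[OF N f(1)] by (auto simp: module_isomorphic_iff)
  have "module_iso (inv_into (primary_space N f) \<psi>) ?D (submodule_record (mat_action N) (primary_space N f))"
    using module_iso_inv[OF \<psi>] mat.action.subspace_add[OF subspace_primary_space[of N f]]
      mat.action.subspace_scale[OF subspace_primary_space[of N f]] by simp
  then show "\<exists>\<phi>. module_iso \<phi> (submodule_record (mat_action M) (primary_space M f))
      (submodule_record (mat_action N) (primary_space N f))"
    using module_iso_trans[OF \<phi>] by blast
qed

section \<open>Intertwining operators and invariance of the class type\<close>

lemma mat_action_in_coord_space:
  assumes "M \<in> carrier_mat n n" "w \<in> coord_space n"
  shows "mat_action M p w \<in> coord_space n"
proof -
  have "dim_row M = n" using assms(1) by simp
  from mat.action.subspace_scale[OF subspace_coord_space[OF this] assms(2)] show ?thesis .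
qed

text \<open>Commutation with x alone propagates to all polynomials. \<open>L\<close> is kept
  general: it will be a change of basis, a matrix commuting with \<open>M\<close>, and a polynomial
  in such a matrix.\<close>

lemma mat_action_intertwine:
  assumes M: "M \<in> carrier_mat n n" and w: "w \<in> coord_space n"
    and add: "\<And>x y. L (x + y) = L x + L y" and scale: "\<And>c x. L (fun_scale c x) = fun_scale c (L x)"
    and comm: "\<And>x. x \<in> coord_space n \<Longrightarrow> L (mat_op M x) = mat_op N (L x)"
  shows "L (mat_action M p w) = mat_action N p (L w)"
proof (induction p)
  case 0
  have "L 0 = 0" using add[of 0 0] by simp
  then show ?case by (simp only: mat.poly_apply_0)
next
  case (pCons a p)
  have "mat_action M p w \<in> coord_space n"
    by (rule mat_action_in_coord_space[OF M w])
  then show ?case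
    by (simp only: mat.poly_apply_pCons add scale comm pCons.IH)
qed

lemma mat_op_add: "mat_op A (x + y) = mat_op A x + mat_op A y"
  by (rule mat.T_add)

lemma mat_op_fun_scale: "mat_op A (fun_scale c x) = fun_scale c (mat_op A x)"
  by (rule mat.T_scale)

text \<open>With \<open>M = P * N * Q\<close> the operator of \<open>Q\<close> maps the kernel of
  f(M)^k bijectively onto that of f(N)^k, and the partition depends only on the sizes of these
  kernels.\<close>

lemma similar_primary_partition_eq:
  fixes M N :: "'a::{field, finite} mat"
  assumes sim: "similar_mat M N" and f: "irreducible f"
  shows "primary_partition M f = primary_partition N f"
proof -
  obtain n P Q where car: "{M, N, P, Q} \<subseteq> carrier_mat n n"
    and PQ: "P * Q = 1\<^sub>m n" "Q * P = 1\<^sub>m n" "M = P * N * Q"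
    using similar_matD[OF sim] by blast
  have M: "M \<in> carrier_mat n n" and N: "N \<in> carrier_mat n n" and P: "P \<in> carrier_mat n n"
    and Q: "Q \<in> carrier_mat n n" using car by auto
  have inv: "mat_op P (mat_op Q w) = w" "mat_op Q (mat_op P w) = w" if "w \<in> coord_space n" for w
    using mat_op_mult[OF P Q that] mat_op_mult[OF Q P that] mat_op_one[OF that] by (simp_all add: PQ)
  have comm: "mat_op Q (mat_op M w) = mat_op N (mat_op Q w)" if w: "w \<in> coord_space n" for w
  proof -
    have "mat_op M w = mat_op P (mat_op N (mat_op Q w))"
      using P N Q w by (simp add: PQ(3) mat_op_mult[of _ n] mat_op_in_coord_space)
    then show ?thesis
      using inv(2) mat_op_in_coord_space[OF N] by simp
  qed
  have bij: "bij_betw (mat_op Q) (coord_space n) (coord_space n)"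
    by (rule bij_betw_byWitness[where f' = "mat_op P"])
      (use inv mat_op_in_coord_space[OF P] mat_op_in_coord_space[OF Q] in auto)
  show ?thesis
  proof (rule primary_partition_eqI[OF M N f])
    fix k
    have eq: "mat_op Q (mat_action M (f ^ k) w) = mat_action N (f ^ k) (mat_op Q w)" if "w \<in> coord_space n" for w
      by (rule mat_action_intertwine[where L = "mat_op Q", OF M that mat_op_add mat_op_fun_scale comm])
    have 0: "mat_action M (f ^ k) w = 0 \<longleftrightarrow> mat_action N (f ^ k) (mat_op Q w) = 0" if w: "w \<in> coord_space n" for w
    proof -
      have "mat_action M (f ^ k) w \<in> coord_space n"
        by (rule mat_action_in_coord_space[OF M w])
      then have "mat_action M (f ^ k) w = 0 \<longleftrightarrow> mat_op Q (mat_action M (f ^ k) w) = 0"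
        using inv(1)[of "mat_action M (f ^ k) w"] mat.T_zero[of P] mat.T_zero[of Q] by auto
      then show ?thesis using eq[OF w] by simp
    qed
    have "bij_betw (mat_op Q) {w \<in> coord_space n. mat_action M (f ^ k) w = 0}
        {w \<in> coord_space n. mat_action N (f ^ k) w = 0}"
      by (rule bij_betw_Collect[OF bij]) (simp add: 0)
    then show "card {w \<in> coord_space n. mat_action M (f ^ k) w = 0} =
        card {w \<in> coord_space n. mat_action N (f ^ k) w = 0}"
      by (rule bij_betw_same_card)
  qed
qed

definition monic_factors :: "'a::field poly \<Rightarrow> 'a poly set" where
  "monic_factors p = {f. lead_coeff f = 1 \<and> irreducible f \<and> f dvd p}"

text \<open>A finite field has only finitely many polynomials of bounded degree. Finiteness matters
  because \<open>mset_set\<close> of an infinite set is empty.\<close>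

lemma finite_monic_factors:
  fixes p :: "'a::{field, finite} poly"
  assumes "p \<noteq> 0"
  shows "finite (monic_factors p)"
proof (rule finite_subset[OF _ finite_polys_bounded[of "Suc (degree p)"]])
  show "monic_factors p \<subseteq> {q. \<forall>i\<ge>Suc (degree p). coeff q i = 0}"
    using dvd_imp_degree_le[OF _ assms] by (auto simp: monic_factors_def intro!: coeff_eq_0 le_imp_less_Suc)
      (metis Suc_le_eq le_less_trans)
qed

lemma char_poly_neq_0: "(M :: 'a::field mat) \<in> carrier_mat n n \<Longrightarrow> char_poly M \<noteq> 0"
  using degree_monic_char_poly[of M n] by auto

lemma ty_similar:
  fixes M N :: "'a::{field, finite} mat"
  assumes "similar_mat M N"
  shows "ty M = ty N"
proof -
  obtain n where "M \<in> carrier_mat n n"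
    using similar_matD[OF assms] by blast
  then have "finite (monic_factors (char_poly N))"
    unfolding char_poly_similar[OF assms, symmetric] by (intro finite_monic_factors char_poly_neq_0)
  then show ?thesis
    unfolding ty_def char_poly_similar[OF assms] monic_factors_def
    by (intro image_mset_cong) (simp add: similar_primary_partition_eq[OF assms])
qed

text \<open>\<open>p\<close> is comaximal to the characteristic polynomial, which acts as zero, so
  \<open>p\<close> acts invertibly.\<close>

lemma coprime_action_inj:
  fixes M :: "'a::field mat"
  assumes M: "M \<in> carrier_mat n n" and w: "w \<in> coord_space n"
    and p: "\<And>f. f \<in> monic_factors (char_poly M) \<Longrightarrow> comaximal p f"
    and 0: "mat_action M p w = 0"
  shows "w = 0"
proof -
  have "monic (char_poly M)"
    using degree_monic_char_poly[OF M] by simp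
  then obtain F k where F: "finite F" "char_poly M = (\<Prod>f\<in>F. f ^ Suc (k f))"
      "F \<subseteq> {f. irreducible f \<and> monic f}"
    using monic_irreducible_factorization by blast
  have "f \<in> monic_factors (char_poly M)" if "f \<in> F" for f
  proof -
    have "f dvd f ^ Suc (k f)" by simp
    also have "\<dots> dvd char_poly M"
      unfolding F(2) using F(1) that by (rule dvd_prodI)
    finally show ?thesis
      using F(3) that by (auto simp: monic_factors_def)
  qed
  then have "comaximal p (\<Prod>f\<in>F. f ^ Suc (k f))"
    by (intro comaximal_prod_right comaximal_power_right p)
  then have "comaximal p (char_poly M)"
    unfolding F(2) .
  then obtain u v where uv: "u * p + v * char_poly M = 1"
    unfolding comaximal_def by blast
  have "w = mat_action M (u * p + v * char_poly M) w"
    by (simp only: uv mat.action.scale_one)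
  also have "\<dots> = mat_action M u (mat_action M p w) + mat_action M v (mat_action M (char_poly M) w)"
    by (simp only: mat.poly_apply_left_add mat.poly_apply_mult)
  also have "\<dots> = 0"
    by (simp only: 0 cayley_hamilton_action[OF M w] mat.action.scale_zero_right add_0)
  finally show ?thesis .
qed

text \<open>Extracts a matching from equal multisets: given \<open>a\<close>, any \<open>b\<close>
  with the same value can be its partner, and both can be removed. For class types it pairs factors
  of equal degree and partition.\<close>

lemma image_mset_eq_imp_bij:
  assumes "finite A" "finite B" "image_mset F (mset_set A) = image_mset G (mset_set B)"
  shows "\<exists>\<sigma>. bij_betw \<sigma> A B \<and> (\<forall>a\<in>A. G (\<sigma> a) = F a)"
  using assms
proof (induction A arbitrary: B rule: finite_induct)
  case empty
  then have "B = {}"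
    by (simp add: mset_set_empty_iff)
  then show ?case by (simp add: bij_betw_def)
next
  case (insert a A)
  have "F a \<in># image_mset G (mset_set B)"
    using insert.hyps insert.prems by (simp flip: insert.prems(2))
  then obtain b where b: "b \<in> B" "G b = F a"
    using insert.prems(1) by auto
  have "mset_set B = add_mset b (mset_set (B - {b}))"
    using insert.prems(1) b(1) by (rule mset_set.remove)
  then have "image_mset F (mset_set A) = image_mset G (mset_set (B - {b}))"
    using insert.prems(2) insert.hyps b(2) by simp
  then obtain \<sigma> where \<sigma>: "bij_betw \<sigma> A (B - {b})" "\<forall>a\<in>A. G (\<sigma> a) = F a"
    using insert.IH[of "B - {b}"] insert.prems(1) by auto
  let ?\<sigma> = "\<sigma>(a := b)"
  have "bij_betw ?\<sigma> A (B - {b})"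
    using \<sigma>(1) insert.hyps(2) by (subst bij_betw_cong[of A ?\<sigma> \<sigma>]) auto
  then have "bij_betw ?\<sigma> (insert a A) B"
    using notIn_Un_bij_betw[of a A ?\<sigma> "B - {b}"] insert.hyps(2) b(1) by (simp add: insert_absorb)
  moreover have "\<forall>x\<in>insert a A. G (?\<sigma> x) = F x"
    using b(2) \<sigma>(2) insert.hyps(2) by auto
  ultimately show ?case by blast
qed

section \<open>Polynomials of a matrix and the passage between matrices of equal type\<close>

lemma pcompose_power: "pcompose (p ^ k) g = pcompose p g ^ k"
  for p g :: "'a::comm_ring_1 poly"
  by (induction k) (simp_all add: pcompose_mult pcompose_1)

lemma mat_action_poly_mat:
  assumes M: "M \<in> carrier_mat n n" and w: "w \<in> coord_space n"
  shows "mat_action (poly_mat g M) p w = mat_action M (pcompose p g) w"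
proof (induction p)
  case (pCons a p)
  let ?u = "mat_action M (pcompose p g) w"
  have "?u \<in> coord_space n"
    by (rule mat_action_in_coord_space[OF M w])
  then obtain v where v: "v \<in> carrier_vec n" "?u = vec_fun v"
    using bij_betw_imp_surj_on[OF bij_betw_vec_fun, of n] by blast
  have "mat_op (poly_mat g M) ?u = mat_action M g ?u"
    unfolding v(2) vec_fun_mult_mat_vec[OF poly_mat_carrier[OF M] v(1), symmetric]
    by (rule vec_fun_poly_mat[OF M v(1)])
  then have "mat_action (poly_mat g M) (pCons a p) w = fun_scale a w + mat_action M g ?u"
    by (simp only: mat.poly_apply_pCons pCons.IH)
  also have "\<dots> = mat_action M (pcompose (pCons a p) g) w"
    by (simp only: pcompose_pCons mat.poly_apply_left_add mat.poly_apply_const mat.poly_apply_mult)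
  finally show ?case .
qed (simp add: mat.poly_apply_0)

lemma irreducible_not_comaximal_dvd: "irreducible f \<Longrightarrow> comaximal f p \<Longrightarrow> \<not> f dvd p"
  unfolding comaximal_def by (metis dvd_add dvd_mult dvd_triv_right Factorial_Ring.irreducible_not_unit)

text \<open>Every monic irreducible \<open>h\<close> must be treated, factor of \<open>N\<close> or
  not. If \<open>h\<close> is paired with the factor \<open>f\<close> of \<open>M\<close>, then h(g)
  is \<open>f\<close> times a polynomial acting invertibly; if \<open>h\<close> is no factor of
  \<open>N\<close>, both kernels are zero.\<close>

lemma poly_mat_similar_if_ty_eq:
  fixes M N :: "'a::{field, finite} mat"
  assumes M: "M \<in> carrier_mat n n" and N: "N \<in> carrier_mat m m" and ty: "ty M = ty N"
  shows "\<exists>g. similar_mat (poly_mat g M) N"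
proof -
  define A B where "A = monic_factors (char_poly M)" and "B = monic_factors (char_poly N)"
  have fin: "finite A" "finite B"
    unfolding A_def B_def using M N by (auto intro!: finite_monic_factors char_poly_neq_0)
  have A: "irreducible f" "lead_coeff f = 1" if "f \<in> A" for f
    using that by (auto simp: A_def monic_factors_def)
  have B: "irreducible h" "lead_coeff h = 1" if "h \<in> B" for h
    using that by (auto simp: B_def monic_factors_def)
  obtain \<sigma> where bij: "bij_betw \<sigma> A B"
    and \<sigma>: "\<And>f. f \<in> A \<Longrightarrow> degree (\<sigma> f) = degree f \<and> primary_partition N (\<sigma> f) = primary_partition M f"
    using image_mset_eq_imp_bij[OF fin ty[unfolded ty_def, folded monic_factors_def A_def B_def]] by auto
  have \<sigma>B: "\<sigma> f \<in> B" if "f \<in> A" for f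
    using bij that by (rule bij_betw_apply)
  have "\<exists>g. f dvd pcompose (\<sigma> f) g \<and> \<not> f\<^sup>2 dvd pcompose (\<sigma> f) g" if "f \<in> A" for f
    using exists_uniformizing_substitution A(1)[OF that] B(1)[OF \<sigma>B[OF that]] \<sigma>[OF that] by metis
  then obtain G where G: "\<And>f. f \<in> A \<Longrightarrow> f dvd pcompose (\<sigma> f) (G f) \<and> \<not> f\<^sup>2 dvd pcompose (\<sigma> f) (G f)"
    by metis
  have comax: "comaximal (f\<^sup>2) (h\<^sup>2)" if "f \<in> A" "h \<in> A" "f \<noteq> h" for f h
    using A that by (intro comaximal_powers monic_irreducible_comaximal) auto
  obtain e where e: "(\<forall>f\<in>A. f\<^sup>2 dvd e f - 1) \<and> (\<forall>f\<in>A. \<forall>h\<in>A. f \<noteq> h \<longrightarrow> f\<^sup>2 dvd e h) \<and>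
      (\<forall>f\<in>A. (\<Prod>f\<in>A. f\<^sup>2) dvd f\<^sup>2 * e f)"
    using comaximal_idempotents[of A "\<lambda>f. f\<^sup>2", OF fin(1) comax] by (rule exE)
  have e0: "f\<^sup>2 dvd e h" if "f \<in> A" "h \<in> A" "f \<noteq> h" for f h
    using e that by simp
  \<comment> \<open>Chinese remaindering: \<open>e f\<close> is 1 modulo \<open>f\<^sup>2\<close>
    and 0 modulo the squares of the other factors, so \<open>g\<close> agrees with
    \<open>G f\<close> modulo \<open>f\<^sup>2\<close>.\<close>
  define g where "g = (\<Sum>f\<in>A. e f * G f)"
  have cong: "f\<^sup>2 dvd pcompose (\<sigma> f) g - pcompose (\<sigma> f) (G f)" if f: "f \<in> A" for f
  proof -
    have "g - G f = (e f - 1) * G f + (\<Sum>h\<in>A - {f}. e h * G h)"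
      using fin(1) f by (simp add: g_def sum.remove algebra_simps)
    moreover have "f\<^sup>2 dvd (e f - 1) * G f"
      using e f by (intro dvd_mult2) blast
    moreover have "f\<^sup>2 dvd (\<Sum>h\<in>A - {f}. e h * G h)"
      using f by (intro dvd_sum dvd_mult2 e0) auto
    ultimately have "f\<^sup>2 dvd g - G f"
      by (simp only: dvd_add)
    then show ?thesis
      using diff_dvd_pcompose_diff by (rule dvd_trans)
  qed
  have g: "f dvd pcompose (\<sigma> f) g" "\<not> f\<^sup>2 dvd pcompose (\<sigma> f) g" if f: "f \<in> A" for f
  proof -
    have "f dvd f\<^sup>2" by (simp add: power2_eq_square)
    then have "f dvd pcompose (\<sigma> f) g - pcompose (\<sigma> f) (G f)"
      using cong[OF f] by (rule dvd_trans)
    from dvd_add[OF this conjunct1[OF G[OF f]]] show "f dvd pcompose (\<sigma> f) g" by simp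
    show "\<not> f\<^sup>2 dvd pcompose (\<sigma> f) g"
    proof
      assume "f\<^sup>2 dvd pcompose (\<sigma> f) g"
      from dvd_diff[OF this cong[OF f]] show False using G[OF f] by simp
    qed
  qed
  \<comment> \<open>Substitute \<open>g\<close> into a Bezout identity for \<open>h\<close> and
    \<open>\<sigma> f\<close>; the second term becomes a multiple of \<open>f\<close>.\<close>
  have comax_other: "comaximal (pcompose h g) f" if f: "f \<in> A" and h: "irreducible h" "lead_coeff h = 1" "h \<noteq> \<sigma> f"
    for f h
  proof -
    have "comaximal h (\<sigma> f)"
      using h B[OF \<sigma>B[OF f]] by (intro monic_irreducible_comaximal) auto
    then obtain a b where "a * h + b * \<sigma> f = 1"
      unfolding comaximal_def by blast
    then have "pcompose (a * h + b * \<sigma> f) g = 1"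
      by (simp add: pcompose_1)
    moreover obtain c where "pcompose (\<sigma> f) g = f * c"
      using g(1)[OF f] by (rule dvdE)
    ultimately have "pcompose a g * pcompose h g + (pcompose b g * c) * f = 1"
      by (simp add: pcompose_add pcompose_mult algebra_simps)
    then show ?thesis
      unfolding comaximal_def by blast
  qed
  let ?H = "poly_mat g M"
  have H: "?H \<in> carrier_mat n n" using M by simp
  have kernel_H: "{w \<in> coord_space n. mat_action ?H (h ^ k) w = 0} =
      {w \<in> coord_space n. mat_action M (pcompose h g ^ k) w = 0}" for h k
    using mat_action_poly_mat[OF M] by (auto simp: pcompose_power)
  have "card {w \<in> coord_space n. mat_action ?H (h ^ k) w = 0} =
      card {w \<in> coord_space m. mat_action N (h ^ k) w = 0}"
    if h: "irreducible h" "lead_coeff h = 1" for h k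
  proof (cases "h \<in> B")
    case True
    then obtain f where f: "f \<in> A" "h = \<sigma> f"
      using bij by (auto simp: bij_betw_def)
    obtain u where u: "pcompose h g = f * u"
      using g(1)[OF f(1)] unfolding f(2) by (rule dvdE)
    \<comment> \<open>The cofactor \<open>u\<close> is prime to \<open>f\<close> because
      \<open>f\<close> divides h(g) only once, and to any other factor \<open>f'\<close> because
      \<open>f'\<close> is paired with a polynomial different from \<open>h\<close>.\<close>
    have "comaximal (u ^ k) f'" if f': "f' \<in> A" for f'
    proof (rule comaximal_sym[OF comaximal_power_right], cases "f' = f")
      case True
      have "\<not> f dvd u"
        using g(2)[OF f(1)] unfolding f(2)[symmetric] u power2_eq_square by (simp add: mult_dvd_mono)
      then show "comaximal f' u"
        using irreducible_comaximal[OF A(1)[OF f(1)]] True by blast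
    next
      case False
      then have "h \<noteq> \<sigma> f'"
        using bij f f' by (auto simp: bij_betw_def inj_on_def)
      then have "\<not> f' dvd pcompose h g"
        using irreducible_not_comaximal_dvd[OF A(1)[OF f']] comaximal_sym[OF comax_other[OF f' h]] by blast
      then have "\<not> f' dvd u"
        unfolding u by auto
      then show "comaximal f' u"
        using irreducible_comaximal[OF A(1)[OF f']] by blast
    qed
    note inj = coprime_action_inj[OF M _ this[unfolded A_def]]
    have "mat_action M (pcompose h g ^ k) w = 0 \<longleftrightarrow> mat_action M (f ^ k) w = 0" if w: "w \<in> coord_space n" for w
    proof -
      have in_V: "mat_action M (f ^ k) w \<in> coord_space n"
        by (rule mat_action_in_coord_space[OF M w])
      have "mat_action M (pcompose h g ^ k) w = mat_action M (u ^ k) (mat_action M (f ^ k) w)"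
        by (simp add: u power_mult_distrib mult.commute)
      then show ?thesis
        using inj[OF in_V] mat.action.scale_zero_right by metis
    qed
    then have "{w \<in> coord_space n. mat_action ?H (h ^ k) w = 0} = {w \<in> coord_space n. mat_action M (f ^ k) w = 0}"
      unfolding kernel_H by blast
    then show ?thesis
      using \<sigma>[OF f(1)] card_kernel_primary_partition[OF N h(1), of k]
      by (simp add: card_kernel_primary_partition[OF M A(1)[OF f(1)]] f(2))
  next
    case False
    \<comment> \<open>No factor of \<open>M\<close> is paired with \<open>h\<close>, so h(g) is
      prime to all of them.\<close>
    have 1: "comaximal (pcompose h g ^ k) f" if "f \<in> monic_factors (char_poly M)" for f
      using comax_other[of f h] False \<sigma>B h that unfolding A_def
      by (metis comaximal_power_right comaximal_sym)
    have 2: "comaximal (h ^ k) f" if "f \<in> monic_factors (char_poly N)" for f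
      using monic_irreducible_comaximal[OF h(1) B(1) h(2) B(2)] False that unfolding B_def
      by (metis comaximal_power_right comaximal_sym)
    have "{w \<in> coord_space n. mat_action ?H (h ^ k) w = 0} = {0}"
      unfolding kernel_H using coprime_action_inj[OF M _ 1] mat.action.scale_zero_right
      by (auto simp: coord_space_def)
    moreover have "{w \<in> coord_space m. mat_action N (h ^ k) w = 0} = {0}"
      using coprime_action_inj[OF N _ 2] mat.action.scale_zero_right
      by (auto simp: coord_space_def)
    ultimately show ?thesis by simp
  qed
  then have "similar_mat ?H N"
    using similar_if_kernel_cards_eq[OF H N] by blast
  then show ?thesis by blast
qed

text \<open>Intertwining twice: \<open>B\<close> commutes with p(A), and then p(A) with
  r(B).\<close>

lemma poly_mat_commute:
  fixes A B :: "'a::field mat"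
  assumes A: "A \<in> carrier_mat n n" and B: "B \<in> carrier_mat n n" and AB: "A * B = B * A"
  shows "poly_mat p A * poly_mat r B = poly_mat r B * poly_mat p A"
proof (rule mat_eq_if_mat_op_eq)
  have op: "mat_op (poly_mat q Z) w = mat_action Z q w"
    if "Z \<in> carrier_mat n n" "w \<in> coord_space n" for q w and Z :: "'a mat"
    using mat_action_poly_mat[OF that, of q "[:0, 1:]"] by (simp add: mat.poly_apply_X pcompose_pCons)
  have comm: "mat_op B (mat_op A x) = mat_op A (mat_op B x)" if "x \<in> coord_space n" for x
    using mat_op_mult[OF A B that] mat_op_mult[OF B A that] AB by simp
  have 1: "mat_op B (mat_action A p x) = mat_action A p (mat_op B x)" if "x \<in> coord_space n" for x
    by (rule mat_action_intertwine[where L = "mat_op B", OF A that mat_op_add mat_op_fun_scale comm])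
  have scale: "mat_action A p (fun_scale c x) = fun_scale c (mat_action A p x)" for c x
    using mat.action.scale_left_commute[of A p "[:c:]" x] by (simp only: mat.poly_apply_const)
  fix w :: "nat \<Rightarrow> 'a" assume w: "w \<in> coord_space n"
  have 2: "mat_action A p (mat_action B r w) = mat_action B r (mat_action A p w)"
    by (rule mat_action_intertwine[where L = "mat_action A p", OF B w mat.poly_apply_right_add scale 1[symmetric]])
  have "mat_action A p w \<in> coord_space n" "mat_action B r w \<in> coord_space n"
    by (rule mat_action_in_coord_space[OF A w], rule mat_action_in_coord_space[OF B w])
  then show "mat_op (poly_mat p A * poly_mat r B) w = mat_op (poly_mat r B * poly_mat p A) w"
    using A B w 2 by (simp add: mat_op_mult[of _ n] op)
qed (intro mult_carrier_mat[of _ n n] poly_mat_carrier A B)+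

theorem theorem2p8:
  fixes C D :: "'q :: {field, finite} mat set"
  assumes "is_similarity_class C" and "is_similarity_class D"
  shows "classes_commute C D \<longleftrightarrow> class_types_commute TYPE('q) (ty_class C) (ty_class D)"
proof -
  \<comment> \<open>\<open>the_elem\<close> has a meaning here because \<open>ty\<close> is constant
    on \<open>E\<close>, so that its image is a singleton.\<close>
  have ty_class: "ty_class E = ty M" if "M \<in> E" "is_similarity_class E" for E and M :: "'q mat"
  proof -
    from that(2) obtain M0 where E: "E = {N. similar_mat M0 N}"
      unfolding is_similarity_class_def by blast
    have "ty N = ty M0" if "N \<in> E" for N
      using ty_similar[of M0 N] that by (simp add: E)
    with that(1) have "ty ` E = {ty M}"
      by (metis (no_types, lifting) image_cong image_constant)
    then show ?thesis
      unfolding ty_class_def by simp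
  qed
  obtain n M where M: "M \<in> carrier_mat n n" "C = {N. similar_mat M N}"
    using assms(1) unfolding is_similarity_class_def by blast
  obtain m M' where M': "M' \<in> carrier_mat m m" "D = {N. similar_mat M' N}"
    using assms(2) unfolding is_similarity_class_def by blast
  have "M \<in> C" "M' \<in> D"
    using M M' similar_mat_refl by auto
  show ?thesis
  proof
    assume "classes_commute C D"
    then show "class_types_commute TYPE('q) (ty_class C) (ty_class D)"
      unfolding classes_commute_def class_types_commute_def
      using ty_class assms by metis
  next
    assume "class_types_commute TYPE('q) (ty_class C) (ty_class D)"
    then obtain A B :: "'q mat" where AB: "commuting_mats A B" "ty A = ty M" "ty B = ty M'"
      unfolding class_types_commute_def
      using ty_class[OF \<open>M \<in> C\<close> assms(1)] ty_class[OF \<open>M' \<in> D\<close> assms(2)] by auto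
    then obtain k where k: "A \<in> carrier_mat k k" "B \<in> carrier_mat k k" "A * B = B * A"
      unfolding commuting_mats_def by blast
    \<comment> \<open>The sizes \<open>k\<close>, \<open>n\<close> and \<open>m\<close> have not
      been compared up to here; similarity to \<open>M\<close> and \<open>M'\<close> forces them to
      agree.\<close>
    obtain p where p: "similar_mat (poly_mat p A) M"
      using poly_mat_similar_if_ty_eq[OF k(1) M(1) AB(2)] by blast
    obtain r where r: "similar_mat (poly_mat r B) M'"
      using poly_mat_similar_if_ty_eq[OF k(2) M'(1) AB(3)] by blast
    have "poly_mat p A \<in> C" "poly_mat r B \<in> D"
      using p r similar_mat_sym unfolding M(2) M'(2) by blast+
    moreover have "commuting_mats (poly_mat p A) (poly_mat r B)"
      unfolding commuting_mats_def using poly_mat_commute[OF k] k by (intro exI[of _ k]) auto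
    ultimately show "classes_commute C D"
      unfolding classes_commute_def by blast
  qed
qed

end
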